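(* Let $(M,g)$ be a compact and connected Riemannian manifold, let $\lambda\in\mathbb{C}$, and let $\mathcal{F}$ be a $(\lambda,\lambda)$-eigenfamily on $M$. Then $\dim_{\mathbb{C}}(\operatorname{span}_{\mathbb{C}}(\mathcal{F}))\leq 1$.
   Context: For a Riemannian manifold $(M,g)$, extend $g$ complex bilinearly to the complexified tangent bundle. For smooth functions $\phi,\psi:M\to\mathbb{C}$ let $\tau(\phi)=\operatorname{div}(\nabla\phi)$ be the (complex linear) Laplace-Beltrami operator and $\kappa(\phi,\psi)=g(\nabla\phi,\nabla\psi)$ (complex bilinear, no conjugation). For $\lambda,\mu\in\mathbb{C}$, a set $\mathcal{F}$ of smooth complex-valued functions on $M$ is a $(\lambda,\mu)$-eigenfamily if for all $\phi,\psi\in\mathcal{F}$ one has $\tau(\phi)=\lambda\phi$ and $\kappa(\phi,\psi)=\mu\,\phi\psi$. Compact manifolds are without boundary. *)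

theory Defs
  imports "HOL-Analysis.Analysis" "HOL-Library.Function_Algebras"
begin

text \<open>Smooth maps on open subsets of a normed space; used for finite-dimensional domains,
  where it is enough to control all iterated directional derivatives.\<close>

primrec Ck_on :: "nat \<Rightarrow> 'e::real_normed_vector set \<Rightarrow> ('e \<Rightarrow> 'b::real_normed_vector) \<Rightarrow> bool" where
  "Ck_on 0 S f \<longleftrightarrow> continuous_on S f"
| "Ck_on (Suc k) S f \<longleftrightarrow> (\<forall>x\<in>S. f differentiable (at x)) \<and>
     (\<forall>v. Ck_on k S (\<lambda>x. frechet_derivative f (at x) v))"

definition smooth_on :: "'e::real_normed_vector set \<Rightarrow> ('e \<Rightarrow> 'b::real_normed_vector) \<Rightarrow> bool" where
  "smooth_on S f \<longleftrightarrow> (\<forall>k. Ck_on k S f)"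


text \<open>A chart is a pair of its domain and its coordinate map; the values of the coordinate map
  outside the domain are irrelevant.\<close>

type_synonym ('a, 'n) chart = "'a set \<times> ('a \<Rightarrow> real ^ 'n)"

definition cdom :: "('a, 'n) chart \<Rightarrow> 'a set" where
  "cdom c = fst c"

definition coords :: "('a, 'n) chart \<Rightarrow> 'a \<Rightarrow> real ^ 'n" where
  "coords c = snd c"

definition cimg :: "('a, 'n) chart \<Rightarrow> (real ^ 'n) set" where
  "cimg c = coords c ` cdom c"

definition cinv :: "('a, 'n) chart \<Rightarrow> real ^ 'n \<Rightarrow> 'a" where
  "cinv c = inv_into (cdom c) (coords c)"

definition is_chart :: "('a::topological_space, 'n::finite) chart \<Rightarrow> bool" where
  "is_chart c \<longleftrightarrow> open (cdom c) \<and> open (cimg c) \<and>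
     homeomorphism (cdom c) (cimg c) (coords c) (cinv c)"

definition partial_deriv ::
    "('a, 'n::finite) chart \<Rightarrow> 'n \<Rightarrow> ('a \<Rightarrow> 'b::real_normed_vector) \<Rightarrow> 'a \<Rightarrow> 'b" where
  "partial_deriv c i f p = frechet_derivative (f \<circ> cinv c) (at (coords c p)) (axis i 1)"

definition transition_deriv ::
    "('a, 'n::finite) chart \<Rightarrow> ('a, 'n) chart \<Rightarrow> 'a \<Rightarrow> real ^ 'n \<Rightarrow> real ^ 'n" where
  "transition_deriv c d p = frechet_derivative (coords d \<circ> cinv c) (at (coords c p))"


text \<open>A tangent vector at \<open>p\<close> is given by its components in all the charts of the atlas around
  \<open>p\<close>, which transform by the differentials of the transition maps. It is normalised to vanish on
  every pair that is not a chart of the atlas around \<open>p\<close>, so that two tangent vectors at \<open>p\<close> are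
  equal as functions iff they have the same components. The vector space operations are pointwise.\<close>

type_synonym ('a, 'n) tvec = "('a, 'n) chart \<Rightarrow> real ^ 'n"

text \<open>The manifold is the whole type \<open>'a\<close>, without boundary, of dimension \<open>CARD('n)\<close>.\<close>

locale smooth_manifold =
  fixes A :: "('a::{t2_space, second_countable_topology}, 'n::finite) chart set"
  assumes charts: "c \<in> A \<Longrightarrow> is_chart c"
    and covers: "(\<Union>c\<in>A. cdom c) = UNIV"
    and compatible: "c \<in> A \<Longrightarrow> d \<in> A \<Longrightarrow>
      smooth_on (coords c ` (cdom c \<inter> cdom d)) (coords d \<circ> cinv c)"
begin

definition smooth :: "('a \<Rightarrow> 'b::real_normed_vector) \<Rightarrow> bool" where
  "smooth f \<longleftrightarrow> (\<forall>c\<in>A. smooth_on (cimg c) (f \<circ> cinv c))"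

definition chart_at :: "'a \<Rightarrow> ('a, 'n) chart" where
  "chart_at p = (SOME c. c \<in> A \<and> p \<in> cdom c)"

definition tangent_space :: "'a \<Rightarrow> ('a, 'n) tvec set" where
  "tangent_space p = {v.
     (\<forall>c. \<not> (c \<in> A \<and> p \<in> cdom c) \<longrightarrow> v c = 0) \<and>
     (\<forall>c\<in>A. \<forall>d\<in>A. p \<in> cdom c \<inter> cdom d \<longrightarrow> v d = transition_deriv c d p (v c))}"

text \<open>The coordinate vector \<open>\<partial>/\<partial>x\<^sup>i\<close> of the chart \<open>c\<close> at \<open>p\<close>.\<close>

definition coord_vec :: "('a, 'n) chart \<Rightarrow> 'n \<Rightarrow> 'a \<Rightarrow> ('a, 'n) tvec" where
  "coord_vec c i p =
     (\<lambda>d. if d \<in> A \<and> p \<in> cdom d then transition_deriv c d p (axis i 1) else 0)"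

text \<open>The derivative \<open>df\<^sub>p(v)\<close>; by the chain rule it does not depend on the chart around \<open>p\<close>.\<close>

definition differential :: "('a \<Rightarrow> real) \<Rightarrow> 'a \<Rightarrow> ('a, 'n) tvec \<Rightarrow> real" where
  "differential f p v =
     (let c = chart_at p in frechet_derivative (f \<circ> cinv c) (at (coords c p)) (v c))"

end


locale riemannian_manifold = smooth_manifold A
  for A :: "('a::{t2_space, second_countable_topology}, 'n::finite) chart set" +
  fixes g :: "'a \<Rightarrow> ('a, 'n) tvec \<Rightarrow> ('a, 'n) tvec \<Rightarrow> real"
  assumes g_sym: "v \<in> tangent_space p \<Longrightarrow> w \<in> tangent_space p \<Longrightarrow> g p v w = g p w v"
    and g_linear: "u \<in> tangent_space p \<Longrightarrow> v \<in> tangent_space p \<Longrightarrow> w \<in> tangent_space p \<Longrightarrow>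
      g p (\<lambda>c. a *\<^sub>R u c + b *\<^sub>R v c) w = a * g p u w + b * g p v w"
    and g_pos: "v \<in> tangent_space p \<Longrightarrow> v \<noteq> (\<lambda>_. 0) \<Longrightarrow> g p v v > 0"
    and g_smooth: "c \<in> A \<Longrightarrow>
      smooth_on (cimg c) (\<lambda>x. g (cinv c x) (coord_vec c i (cinv c x)) (coord_vec c j (cinv c x)))"
begin

definition metric_coeff :: "('a, 'n) chart \<Rightarrow> 'n \<Rightarrow> 'n \<Rightarrow> 'a \<Rightarrow> real" where
  "metric_coeff c i j p = g p (coord_vec c i p) (coord_vec c j p)"

definition inv_metric_coeff :: "('a, 'n) chart \<Rightarrow> 'n \<Rightarrow> 'n \<Rightarrow> 'a \<Rightarrow> real" where
  "inv_metric_coeff c i j p = matrix_inv (\<chi> k l. metric_coeff c k l p) $ i $ j"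

text \<open>The Christoffel symbols \<open>\<Gamma>\<^sup>k\<^sub>i\<^sub>j\<close> of the Levi-Civita connection, with arguments in the order
  \<open>k i j\<close>.\<close>

definition christoffel :: "('a, 'n) chart \<Rightarrow> 'n \<Rightarrow> 'n \<Rightarrow> 'n \<Rightarrow> 'a \<Rightarrow> real" where
  "christoffel c k i j p = (1 / 2) * (\<Sum>l\<in>UNIV. inv_metric_coeff c k l p *
     (partial_deriv c i (metric_coeff c j l) p + partial_deriv c j (metric_coeff c i l) p
        - partial_deriv c l (metric_coeff c i j) p))"

text \<open>The \<open>k\<close>-th component, in the chart \<open>c\<close>, of the covariant derivative of the vector field \<open>X\<close>
  in the direction \<open>\<partial>/\<partial>x\<^sup>i\<close>.\<close>

definition cov_deriv :: "('a, 'n) chart \<Rightarrow> 'n \<Rightarrow> 'n \<Rightarrow> ('a \<Rightarrow> ('a, 'n) tvec) \<Rightarrow> 'a \<Rightarrow> real" where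
  "cov_deriv c k i X p = partial_deriv c i (\<lambda>q. X q c $ k) p
     + (\<Sum>j\<in>UNIV. christoffel c k i j p * X p c $ j)"

text \<open>\<open>div X\<close> is the trace of \<open>v \<mapsto> \<nabla>\<^sub>v X\<close>, computed in a chart around the point; the trace does
  not depend on that chart.\<close>

definition divergence :: "('a \<Rightarrow> ('a, 'n) tvec) \<Rightarrow> 'a \<Rightarrow> real" where
  "divergence X p = (\<Sum>i\<in>UNIV. cov_deriv (chart_at p) i i X p)"

definition gradient :: "('a \<Rightarrow> real) \<Rightarrow> 'a \<Rightarrow> ('a, 'n) tvec" where
  "gradient f p = (THE X. X \<in> tangent_space p \<and>
     (\<forall>v\<in>tangent_space p. g p X v = differential f p v))"


text \<open>A vector \<open>X + \<i>Y\<close> of the complexified tangent space is the pair \<open>(X, Y)\<close>. The following are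
  the complex (bi)linear extensions of the metric, the divergence and the gradient.\<close>

definition metric_C ::
    "'a \<Rightarrow> ('a, 'n) tvec \<times> ('a, 'n) tvec \<Rightarrow> ('a, 'n) tvec \<times> ('a, 'n) tvec \<Rightarrow> complex" where
  "metric_C p V W = Complex (g p (fst V) (fst W) - g p (snd V) (snd W))
                            (g p (fst V) (snd W) + g p (snd V) (fst W))"

definition divergence_C :: "('a \<Rightarrow> ('a, 'n) tvec \<times> ('a, 'n) tvec) \<Rightarrow> 'a \<Rightarrow> complex" where
  "divergence_C V p = Complex (divergence (\<lambda>q. fst (V q)) p) (divergence (\<lambda>q. snd (V q)) p)"

definition gradient_C :: "('a \<Rightarrow> complex) \<Rightarrow> 'a \<Rightarrow> ('a, 'n) tvec \<times> ('a, 'n) tvec" where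
  "gradient_C \<phi> p = (gradient (\<lambda>q. Re (\<phi> q)) p, gradient (\<lambda>q. Im (\<phi> q)) p)"

definition tau :: "('a \<Rightarrow> complex) \<Rightarrow> 'a \<Rightarrow> complex" where
  "tau \<phi> = divergence_C (gradient_C \<phi>)"

definition kappa :: "('a \<Rightarrow> complex) \<Rightarrow> ('a \<Rightarrow> complex) \<Rightarrow> 'a \<Rightarrow> complex" where
  "kappa \<phi> \<psi> p = metric_C p (gradient_C \<phi> p) (gradient_C \<psi> p)"

definition eigenfamily :: "complex \<Rightarrow> complex \<Rightarrow> ('a \<Rightarrow> complex) set \<Rightarrow> bool" where
  "eigenfamily lam mu F \<longleftrightarrow>
     (\<forall>\<phi>\<in>F. smooth \<phi>) \<and>
     (\<forall>\<phi>\<in>F. \<forall>\<psi>\<in>F. (\<forall>p. tau \<phi> p = lam * \<phi> p) \<and> (\<forall>p. kappa \<phi> \<psi> p = mu * \<phi> p * \<psi> p))"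

end


definition cscale :: "complex \<Rightarrow> ('a \<Rightarrow> complex) \<Rightarrow> 'a \<Rightarrow> complex" where
  "cscale a f = (\<lambda>x. a * f x)"

global_interpretation cfun: vector_space "cscale :: complex \<Rightarrow> ('a \<Rightarrow> complex) \<Rightarrow> 'a \<Rightarrow> complex"
  defines cfun_span = cfun.span and cfun_dim = cfun.dim
  by unfold_locales (auto simp: cscale_def fun_eq_iff algebra_simps)

text \<open>\<open>cfun_dim\<close> is \<open>0\<close> on infinite-dimensional spaces, so a bound on the dimension has to be
  accompanied by finite-dimensionality.\<close>

definition cfun_fin_dim :: "('a \<Rightarrow> complex) set \<Rightarrow> bool" where
  "cfun_fin_dim V \<longleftrightarrow> (\<exists>B. finite B \<and> cfun_span B = V)"

end

theory Submission
  imports Defs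
begin

text \<open>Let \<open>\<phi>\<close>, \<open>\<psi>\<close> be members of the family and \<open>\<zeta> = \<phi> - k \<psi>\<close>. By linearity
  \<open>\<tau>(\<zeta>) = \<lambda> \<zeta>\<close> and \<open>\<kappa>(\<zeta>, \<zeta>) = \<lambda> \<zeta>\<^sup>2\<close>, so \<open>log \<bar>\<zeta>\<bar>\<close> is harmonic where \<open>\<zeta> \<noteq> 0\<close>.
  By Hopf's strong maximum principle the set where \<open>\<bar>\<zeta>\<bar>\<close> attains a positive maximum is open;
  it is also closed, so \<open>\<bar>\<zeta>\<bar>\<close> is constant on the connected manifold. Hence \<open>\<zeta>\<close>
  vanishes everywhere as soon as it vanishes somewhere, which is arranged at any given point by the
  choice of \<open>k\<close>. The maximum principle is applied in a fixed chart with the coordinate expression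
  of the Laplacian, while \<open>divergence\<close> uses a chart that depends on the point; this is why the
  invariance of the divergence under changes of charts is needed.\<close>

subsection \<open>Smooth maps and symmetry of second derivatives\<close>

text \<open>Equality of the two eigenvalues is what makes the logarithm harmonic: formally the
  Laplacian of log \<open>\<zeta>\<close> is
  \<open>tau \<zeta> / \<zeta> - kappa \<zeta> \<zeta> / \<zeta>^2\<close>, that is
  \<open>lam - lam\<close>, and its real part is the Laplacian of log |\<open>\<zeta>\<close>|. To
  avoid branches and logarithms, the proof works with F = |\<open>\<zeta>\<close>|^2 and the
  equation F Lap F - |grad F|^2 = 0. This is quadratic in F, but with F and grad F frozen in the
  coefficients it says that the linear operator F Lap - g(grad F, grad .) annihilates F. That
  operator is elliptic where F > 0 and has no term of order zero, so the strong maximum principle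
  applies for every complex \<open>lam\<close>. The partial derivatives of F are written out
  explicitly and handed to the maximum principle as families of functions. Smoothness in the sense
  of \<open>Ck_on\<close> therefore only has to be stable under linear maps and sums, not under
  products.\<close>

lemma frechet_derivative_eqI:
  "(f has_derivative f') (at x) \<Longrightarrow> frechet_derivative f (at x) = f'"
  by (rule frechet_derivative_at[symmetric])

text \<open>\<open>frechet_derivative\<close> is taken in the whole space, so it is determined by
  the values on \<open>S\<close> only because \<open>S\<close> is open. The inductions below use
  this to replace the derivative of a combination by its formula.\<close>

lemma Ck_on_cong:
  assumes "open S" "Ck_on k S f" "\<And>x. x \<in> S \<Longrightarrow> f x = h x"
  shows "Ck_on k S h"
  using assms(2,3)
proof (induction k arbitrary: f h)
  case 0
  then show ?case by (simp cong: continuous_on_cong_simp)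
next
  case (Suc k)
  have d: "f differentiable (at x)" if "x \<in> S" for x
    using Suc.prems(1) that by simp
  have hd: "(h has_derivative frechet_derivative f (at x)) (at x)" if "x \<in> S" for x
    using has_derivative_transform_within_open[OF _ \<open>open S\<close> that Suc.prems(2)] d[OF that]
    by (simp add: frechet_derivative_works)
  have "Ck_on k S (\<lambda>x. frechet_derivative h (at x) v)" for v
    using Suc.IH[of "\<lambda>x. frechet_derivative f (at x) v"] Suc.prems(1)
    by (simp add: frechet_derivative_eqI[OF hd])
  then show ?case using hd by (auto simp: differentiable_def)
qed

text \<open>The derivative of the composite is again \<open>L\<close> applied to a derivative of
  \<open>f\<close>, hence the induction generalises over \<open>f\<close>. Sums are handled in the
  same way.\<close>

lemma Ck_on_linear_compose:
  assumes "open S" "Ck_on k S f" "bounded_linear L"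
  shows "Ck_on k S (\<lambda>x. L (f x))"
  using assms(2)
proof (induction k arbitrary: f)
  case 0
  then show ?case
    using bounded_linear.continuous_on[OF assms(3)] by simp
next
  case (Suc k)
  have hd: "((\<lambda>x. L (f x)) has_derivative (\<lambda>v. L (frechet_derivative f (at x) v))) (at x)"
    if "x \<in> S" for x
    using Suc.prems that
    by (intro bounded_linear.has_derivative[OF assms(3)]) (simp add: frechet_derivative_works)
  have "Ck_on k S (\<lambda>x. frechet_derivative (\<lambda>x. L (f x)) (at x) v)" for v
    by (rule Ck_on_cong[OF \<open>open S\<close> Suc.IH[of "\<lambda>x. frechet_derivative f (at x) v"]])
       (use Suc.prems in \<open>auto simp: frechet_derivative_eqI[OF hd]\<close>)
  then show ?case using hd by (auto simp: differentiable_def)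
qed

lemma Ck_on_add:
  assumes "open S" "Ck_on k S f" "Ck_on k S h"
  shows "Ck_on k S (\<lambda>x. f x + h x)"
  using assms(2,3)
proof (induction k arbitrary: f h)
  case 0
  then show ?case by (simp add: continuous_on_add)
next
  case (Suc k)
  have hd: "((\<lambda>x. f x + h x) has_derivative
      (\<lambda>v. frechet_derivative f (at x) v + frechet_derivative h (at x) v)) (at x)"
    if "x \<in> S" for x
    using Suc.prems that
    by (intro has_derivative_add) (simp_all add: frechet_derivative_works)
  have "Ck_on k S (\<lambda>x. frechet_derivative (\<lambda>x. f x + h x) (at x) v)" for v
    by (rule Ck_on_cong[OF \<open>open S\<close> Suc.IH[of "\<lambda>x. frechet_derivative f (at x) v"
          "\<lambda>x. frechet_derivative h (at x) v"]])
       (use Suc.prems in \<open>auto simp: frechet_derivative_eqI[OF hd]\<close>)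
  then show ?case using hd by (auto simp: differentiable_def)
qed

lemma smooth_on_differentiable:
  "smooth_on S f \<Longrightarrow> x \<in> S \<Longrightarrow> f differentiable (at x)"
  unfolding smooth_on_def by (metis Ck_on.simps(2))

lemma smooth_on_has_derivative:
  "smooth_on S f \<Longrightarrow> x \<in> S \<Longrightarrow> (f has_derivative frechet_derivative f (at x)) (at x)"
  using smooth_on_differentiable frechet_derivative_works by blast

lemma smooth_on_frechet_derivative:
  "smooth_on S f \<Longrightarrow> smooth_on S (\<lambda>x. frechet_derivative f (at x) v)"
  unfolding smooth_on_def by (metis Ck_on.simps(2))

lemma smooth_on_continuous_on: "smooth_on S f \<Longrightarrow> continuous_on S f"
  unfolding smooth_on_def by (metis Ck_on.simps(1))

lemma smooth_on_linear_compose: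
  "open S \<Longrightarrow> smooth_on S f \<Longrightarrow> bounded_linear L \<Longrightarrow> smooth_on S (\<lambda>x. L (f x))"
  unfolding smooth_on_def by (simp add: Ck_on_linear_compose)

lemma smooth_on_add:
  "open S \<Longrightarrow> smooth_on S f \<Longrightarrow> smooth_on S h \<Longrightarrow> smooth_on S (\<lambda>x. f x + h x)"
  unfolding smooth_on_def by (simp add: Ck_on_add)

section \<open>Symmetry of second derivatives\<close>

text \<open>Restricting to a line makes the one-variable mean value theorem available, both here and
  in the second derivative test at a maximum.\<close>

lemma has_derivative_along_line:
  fixes f :: "'e::real_normed_vector \<Rightarrow> 'b::real_normed_vector"
  assumes "(f has_derivative f') (at (y + t *\<^sub>R v))"
  shows "((\<lambda>t. f (y + t *\<^sub>R v)) has_vector_derivative f' v) (at t)"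
proof -
  have "((\<lambda>t. y + t *\<^sub>R v) has_derivative (\<lambda>s. s *\<^sub>R v)) (at t)"
    by (auto intro!: derivative_eq_intros)
  from has_derivative_compose[OF this assms]
  have "((\<lambda>t. f (y + t *\<^sub>R v)) has_derivative (\<lambda>s. f' (s *\<^sub>R v))) (at t)" .
  then show ?thesis
    unfolding has_vector_derivative_def
    using linear_cmul[OF has_derivative_linear[OF assms]] by simp
qed

text \<open>Both mixed derivatives are the limit of the second difference quotient.\<close>

lemma second_difference_mean_value:
  fixes f :: "'e::real_normed_vector \<Rightarrow> real"
  assumes f: "\<And>y. y \<in> S \<Longrightarrow> (f has_derivative f' y) (at y)"
    and f': "\<And>y. y \<in> S \<Longrightarrow> ((\<lambda>z. f' z v) has_derivative f'' y) (at y)"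
    and S: "\<And>a b. 0 \<le> a \<Longrightarrow> a \<le> s \<Longrightarrow> 0 \<le> b \<Longrightarrow> b \<le> s \<Longrightarrow> x + a *\<^sub>R v + b *\<^sub>R w \<in> S"
    and "s > 0"
  shows "\<exists>a b. 0 \<le> a \<and> a \<le> s \<and> 0 \<le> b \<and> b \<le> s \<and>
    f (x + s *\<^sub>R v + s *\<^sub>R w) - f (x + s *\<^sub>R v) - f (x + s *\<^sub>R w) + f x
      = s * s * f'' (x + a *\<^sub>R v + b *\<^sub>R w) w"
proof -
  \<comment> \<open>The second difference is the increment over [0, s] of \<open>u\<close>, which is
    the first difference in direction \<open>w\<close>, moved along \<open>v\<close>. The mean value
    theorem for \<open>u\<close> differentiates along \<open>v\<close>; the one for \<open>k\<close>
    below then differentiates along \<open>w\<close>.\<close>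
  define u where "u t = f ((x + s *\<^sub>R w) + t *\<^sub>R v) - f (x + t *\<^sub>R v)" for t
  have du: "(u has_real_derivative (f' ((x + s *\<^sub>R w) + t *\<^sub>R v) v - f' (x + t *\<^sub>R v) v)) (at t)"
    if "0 \<le> t" "t \<le> s" for t
    unfolding u_def has_real_derivative_iff_has_vector_derivative
    using S[of t s] S[of t 0] that \<open>s > 0\<close>
    by (intro has_vector_derivative_diff has_derivative_along_line f) (simp_all add: algebra_simps)
  from MVT2[OF \<open>0 < s\<close> du] obtain a where a: "0 < a" "a < s"
    and ua: "u s - u 0 = (s - 0) * (f' ((x + s *\<^sub>R w) + a *\<^sub>R v) v - f' (x + a *\<^sub>R v) v)"
    by auto
  define k where "k t = f' ((x + a *\<^sub>R v) + t *\<^sub>R w) v" for t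
  have dk: "(k has_real_derivative f'' ((x + a *\<^sub>R v) + t *\<^sub>R w) w) (at t)"
    if "0 \<le> t" "t \<le> s" for t
    unfolding k_def has_real_derivative_iff_has_vector_derivative
    using S[of a t] that a by (intro has_derivative_along_line f') (simp add: algebra_simps)
  from MVT2[OF \<open>0 < s\<close> dk] obtain b where b: "0 < b" "b < s"
    and kb: "k s - k 0 = (s - 0) * f'' ((x + a *\<^sub>R v) + b *\<^sub>R w) w"
    by auto
  have "u s - u 0 = s * (k s - k 0)"
    using ua by (simp add: k_def algebra_simps)
  then have "u s - u 0 = s * s * f'' (x + a *\<^sub>R v + b *\<^sub>R w) w"
    by (simp add: kb)
  moreover have "u s - u 0 = f (x + s *\<^sub>R v + s *\<^sub>R w) - f (x + s *\<^sub>R v) - f (x + s *\<^sub>R w) + f x"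
    by (simp add: u_def algebra_simps)
  ultimately show ?thesis
    using a b by (intro exI[of _ a] exI[of _ b]) auto
qed

text \<open>The intermediate point of the mean value theorem tends to \<open>x\<close> with
  \<open>s\<close>, so continuity of the iterated derivative suffices.\<close>

lemma mixed_second_derivatives_close:
  fixes f :: "'e::real_normed_vector \<Rightarrow> real"
  assumes "open S" "x \<in> S" "smooth_on S f" "e > 0"
  shows "\<exists>d>0. \<forall>s. 0 < s \<and> s < d \<longrightarrow>
    \<bar>(f (x + s *\<^sub>R v + s *\<^sub>R w) - f (x + s *\<^sub>R v) - f (x + s *\<^sub>R w) + f x) / (s * s)
      - frechet_derivative (\<lambda>y. frechet_derivative f (at y) v) (at x) w\<bar> < e"
proof -
  let ?q = "\<lambda>y. frechet_derivative (\<lambda>z. frechet_derivative f (at z) v) (at y) w"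
  have "continuous_on S ?q"
    using assms(3) by (intro smooth_on_continuous_on smooth_on_frechet_derivative)
  then have "isCont ?q x"
    using assms(1,2) continuous_on_eq_continuous_at by blast
  then obtain r0 where r0: "r0 > 0" "\<And>y. dist y x < r0 \<Longrightarrow> dist (?q y) (?q x) < e"
    unfolding continuous_at_eps_delta using \<open>e > 0\<close> by blast
  obtain r1 where r1: "r1 > 0" "ball x r1 \<subseteq> S"
    using assms(1,2) open_contains_ball by blast
  define r where "r = min r0 r1"
  \<comment> \<open>Chosen so that the whole parallelogram of side parameters below \<open>d\<close>
    lies within distance \<open>r\<close> of \<open>x\<close>; the 1 keeps the denominator positive
    when \<open>v\<close> and \<open>w\<close> vanish.\<close>
  define d where "d = r / (norm v + norm w + 1)"
  have pos: "norm v + norm w + 1 > 0"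
    by (metis add_nonneg_pos add_nonneg_nonneg norm_ge_zero zero_less_one)
  have "r > 0" using r0 r1 by (simp add: r_def)
  have "d > 0" using \<open>r > 0\<close> pos by (simp add: d_def)
  have near: "dist (x + a *\<^sub>R v + b *\<^sub>R w) x < r"
    if "0 \<le> a" "a \<le> s" "0 \<le> b" "b \<le> s" "0 < s" "s < d" for a b s
  proof -
    have "dist (x + a *\<^sub>R v + b *\<^sub>R w) x = norm (a *\<^sub>R v + b *\<^sub>R w)"
      by (simp add: dist_norm)
    also have "\<dots> \<le> a * norm v + b * norm w"
      using norm_triangle_ineq[of "a *\<^sub>R v" "b *\<^sub>R w"] that by simp
    also have "\<dots> \<le> s * norm v + s * norm w"
      using that by (intro add_mono mult_right_mono) auto
    also have "\<dots> < s * (norm v + norm w + 1)"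
      using that by (simp add: algebra_simps)
    also have "\<dots> < d * (norm v + norm w + 1)"
      using that pos by (intro mult_strict_right_mono)
    also have "\<dots> = r" using pos by (simp add: d_def)
    finally show ?thesis .
  qed
  show ?thesis
  proof (intro exI[of _ d] conjI allI impI)
    show "d > 0" by fact
    fix s assume s: "0 < s \<and> s < d"
    have "x + a *\<^sub>R v + b *\<^sub>R w \<in> S" if "0 \<le> a" "a \<le> s" "0 \<le> b" "b \<le> s" for a b
      using near[OF that] s r1 by (auto simp: r_def dist_commute)
    then obtain a b where ab: "0 \<le> a" "a \<le> s" "0 \<le> b" "b \<le> s"
      and eq: "f (x + s *\<^sub>R v + s *\<^sub>R w) - f (x + s *\<^sub>R v) - f (x + s *\<^sub>R w) + f x
        = s * s * ?q (x + a *\<^sub>R v + b *\<^sub>R w)"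
      using second_difference_mean_value[where f=f and S=S and f'="\<lambda>y. frechet_derivative f (at y)"
          and f''="\<lambda>y. frechet_derivative (\<lambda>z. frechet_derivative f (at z) v) (at y)"
          and v=v and w=w and s=s and x=x]
        smooth_on_has_derivative[OF assms(3)]
        smooth_on_has_derivative[OF smooth_on_frechet_derivative[OF assms(3)]] s
      by blast
    have "dist (?q (x + a *\<^sub>R v + b *\<^sub>R w)) (?q x) < e"
      using near[OF ab] s by (intro r0) (auto simp: r_def)
    then show "\<bar>(f (x + s *\<^sub>R v + s *\<^sub>R w) - f (x + s *\<^sub>R v) - f (x + s *\<^sub>R w) + f x) / (s * s)
      - ?q x\<bar> < e"
      using s by (simp add: eq dist_real_def)
  qed
qed

text \<open>The second difference quotient is unchanged when \<open>v\<close> and \<open>w\<close>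
  are exchanged, and for small \<open>s\<close> it is close to both iterated derivatives. With
  \<open>e\<close> half of their supposed distance this is a contradiction.\<close>

lemma second_derivative_symmetric_real:
  fixes f :: "'e::real_normed_vector \<Rightarrow> real"
  assumes "open S" "x \<in> S" "smooth_on S f"
  shows "frechet_derivative (\<lambda>y. frechet_derivative f (at y) v) (at x) w =
    frechet_derivative (\<lambda>y. frechet_derivative f (at y) w) (at x) v" (is "?a = ?b")
proof (rule ccontr)
  assume "?a \<noteq> ?b"
  define e where "e = \<bar>?a - ?b\<bar> / 2"
  have "e > 0" using \<open>?a \<noteq> ?b\<close> by (simp add: e_def)
  obtain d1 where d1: "d1 > 0" "\<And>s. 0 < s \<and> s < d1 \<Longrightarrow>
    \<bar>(f (x + s *\<^sub>R v + s *\<^sub>R w) - f (x + s *\<^sub>R v) - f (x + s *\<^sub>R w) + f x) / (s * s) - ?a\<bar> < e"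
    using mixed_second_derivatives_close[OF assms \<open>e > 0\<close>, of v w] by blast
  obtain d2 where d2: "d2 > 0" "\<And>s. 0 < s \<and> s < d2 \<Longrightarrow>
    \<bar>(f (x + s *\<^sub>R w + s *\<^sub>R v) - f (x + s *\<^sub>R w) - f (x + s *\<^sub>R v) + f x) / (s * s) - ?b\<bar> < e"
    using mixed_second_derivatives_close[OF assms \<open>e > 0\<close>, of w v] by blast
  define s where "s = min d1 d2 / 2"
  define Q where "Q = (f (x + s *\<^sub>R v + s *\<^sub>R w) - f (x + s *\<^sub>R v) - f (x + s *\<^sub>R w) + f x) / (s * s)"
  have "\<bar>Q - ?a\<bar> < e" using d1 d2 unfolding Q_def by (intro d1(2)) (auto simp: s_def)
  moreover have "\<bar>(f (x + s *\<^sub>R w + s *\<^sub>R v) - f (x + s *\<^sub>R w) - f (x + s *\<^sub>R v) + f x) / (s * s) - ?b\<bar> < e"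
    using d1 d2 by (intro d2(2)) (auto simp: s_def)
  then have "\<bar>Q - ?b\<bar> < e" by (simp add: Q_def algebra_simps)
  ultimately have "\<bar>?a - ?b\<bar> < e + e" by linarith
  then show False by (simp add: e_def)
qed

text \<open>The mean value theorem is scalar, so the claim is reduced to the components along a
  basis. The vector-valued form is what transition maps require.\<close>

lemma second_derivative_symmetric:
  fixes f :: "'e::real_normed_vector \<Rightarrow> 'b::euclidean_space"
  assumes "open S" "x \<in> S" "smooth_on S f"
  shows "frechet_derivative (\<lambda>y. frechet_derivative f (at y) v) (at x) w =
    frechet_derivative (\<lambda>y. frechet_derivative f (at y) w) (at x) v"
proof (rule euclidean_eqI)
  fix b :: 'b
  have s: "smooth_on S (\<lambda>y. f y \<bullet> b)"
    by (rule smooth_on_linear_compose[OF assms(1,3) bounded_linear_inner_left])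
  have 1: "frechet_derivative (\<lambda>y. f y \<bullet> b) (at y) u = frechet_derivative f (at y) u \<bullet> b"
    if "y \<in> S" for y u
    by (subst frechet_derivative_eqI[OF has_derivative_inner_left[OF smooth_on_has_derivative[OF assms(3) that]]]) simp
  have 2: "frechet_derivative (\<lambda>y. frechet_derivative (\<lambda>y. f y \<bullet> b) (at y) u) (at x) u'
      = frechet_derivative (\<lambda>y. frechet_derivative f (at y) u) (at x) u' \<bullet> b" for u u'
  proof -
    have "((\<lambda>y. frechet_derivative f (at y) u \<bullet> b) has_derivative
        (\<lambda>h. frechet_derivative (\<lambda>y. frechet_derivative f (at y) u) (at x) h \<bullet> b)) (at x)"
      by (intro has_derivative_inner_left smooth_on_has_derivative[OF smooth_on_frechet_derivative[OF assms(3)] assms(2)])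
    then have "((\<lambda>y. frechet_derivative (\<lambda>y. f y \<bullet> b) (at y) u) has_derivative
        (\<lambda>h. frechet_derivative (\<lambda>y. frechet_derivative f (at y) u) (at x) h \<bullet> b)) (at x)"
      by (rule has_derivative_transform_within_open[OF _ assms(1,2)]) (simp add: 1)
    then show ?thesis by (simp add: frechet_derivative_eqI)
  qed
  show "frechet_derivative (\<lambda>y. frechet_derivative f (at y) v) (at x) w \<bullet> b =
    frechet_derivative (\<lambda>y. frechet_derivative f (at y) w) (at x) v \<bullet> b"
    using second_derivative_symmetric_real[OF assms(1,2) s, of v w] by (simp add: 2)
qed

subsection \<open>The divergence in coordinates\<close>

lemma matrix_add_rdistrib: "(B + C) ** A = B ** A + C ** (A :: 'a::semiring_1^'p^'n)"
  by (vector matrix_matrix_mult_def sum.distrib[symmetric] algebra_simps)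

lemma bounded_bilinear_matrix_matrix_mult:
  "bounded_bilinear ((**) :: real^'n^'m \<Rightarrow> real^'p^'n \<Rightarrow> real^'p^'m)"
proof -
  have "bilinear ((**) :: real^'n^'m \<Rightarrow> real^'p^'n \<Rightarrow> real^'p^'m)"
    unfolding bilinear_def
    by (auto intro!: linearI simp: matrix_add_ldistrib matrix_add_rdistrib
        scalar_matrix_assoc[symmetric] matrix_scalar_ac)
  then show ?thesis by (simp add: bilinear_conv_bounded_bilinear)
qed

lemma bounded_bilinear_matrix_vector_mult:
  "bounded_bilinear ((*v) :: real^'n^'m \<Rightarrow> real^'n \<Rightarrow> real^'m)"
proof -
  have "bilinear ((*v) :: real^'n^'m \<Rightarrow> real^'n \<Rightarrow> real^'m)"
    unfolding bilinear_def
    by (auto intro!: linearI simp: matrix_vector_right_distrib matrix_vector_mult_add_rdistrib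
        scaleR_matrix_vector_assoc[symmetric] matrix_vector_mult_scaleR)
  then show ?thesis by (simp add: bilinear_conv_bounded_bilinear)
qed

lemmas has_derivative_matrix_matrix_mult =
  bounded_bilinear.FDERIV[OF bounded_bilinear_matrix_matrix_mult]
lemmas has_derivative_matrix_vector_mult =
  bounded_bilinear.FDERIV[OF bounded_bilinear_matrix_vector_mult]

lemma bounded_linear_transpose: "bounded_linear (transpose :: real^'n^'m \<Rightarrow> real^'m^'n)"
  by (intro linear_linear[THEN iffD2] linearI) (simp_all add: transpose_def vec_eq_iff)

lemma bounded_linear_trace: "bounded_linear (trace :: real^'n^'n \<Rightarrow> real)"
  by (intro linear_linear[THEN iffD2] linearI)
     (simp_all add: trace_def sum.distrib sum_distrib_left)

lemma has_derivative_vecI: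
  fixes f :: "'e::real_normed_vector \<Rightarrow> 'b::euclidean_space ^ 'n"
  assumes "\<And>i. ((\<lambda>x. f x $ i) has_derivative (\<lambda>h. f' h $ i)) (at x)"
  shows "(f has_derivative f') (at x)"
proof (subst has_derivative_componentwise_within, intro ballI)
  fix b :: "'b^'n" assume "b \<in> Basis"
  then obtain i u where b: "b = axis i u" by (auto simp: Basis_vec_def)
  show "((\<lambda>x. f x \<bullet> b) has_derivative (\<lambda>x. f' x \<bullet> b)) (at x)"
    unfolding b inner_axis by (intro has_derivative_inner_left assms)
qed

lemma differentiable_vecI:
  fixes f :: "'e::real_normed_vector \<Rightarrow> 'b::euclidean_space ^ 'n"
  assumes "\<And>i. (\<lambda>x. f x $ i) differentiable (at x)"
  shows "f differentiable (at x)"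
proof -
  have "(f has_derivative (\<lambda>h. \<chi> i. frechet_derivative (\<lambda>x. f x $ i) (at x) h)) (at x)"
    by (rule has_derivative_vecI) (use assms in \<open>simp add: frechet_derivative_works\<close>)
  then show ?thesis by (auto simp: differentiable_def)
qed

lemma has_derivative_vec_nth:
  "(f has_derivative f') F \<Longrightarrow> ((\<lambda>x. f x $ i) has_derivative (\<lambda>h. f' h $ i)) F"
  by (rule bounded_linear.has_derivative[OF bounded_linear_vec_nth])

lemma differentiable_vec_nth:
  "f differentiable F \<Longrightarrow> (\<lambda>x. f x $ i) differentiable F"
  unfolding differentiable_def using has_derivative_vec_nth by blast

lemma differentiable_prod:
  fixes f :: "'i \<Rightarrow> 'e::real_normed_vector \<Rightarrow> real"
  assumes "\<And>i. i \<in> I \<Longrightarrow> f i differentiable (at x)"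
  shows "(\<lambda>x. \<Prod>i\<in>I. f i x) differentiable (at x)"
  using has_derivative_prod[of I f "\<lambda>i. frechet_derivative (f i) (at x)" x UNIV] assms
  by (auto simp: differentiable_def frechet_derivative_works[symmetric])

lemma differentiable_det:
  fixes M :: "'e::real_normed_vector \<Rightarrow> real^'n^'n"
  assumes "\<And>i j. (\<lambda>x. M x $ i $ j) differentiable (at x)"
  shows "(\<lambda>x. det (M x)) differentiable (at x)"
  unfolding det_def
  by (intro differentiable_sum differentiable_mult differentiable_const differentiable_prod assms ballI)
     (simp add: finite_permutations)

lemma matrix_inv_inverse:
  assumes "invertible (M :: real^'n^'n)"
  shows "M ** matrix_inv M = mat 1" "matrix_inv M ** M = mat 1"
  using someI_ex[OF assms[unfolded invertible_def]] by (simp_all add: matrix_inv_def)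

text \<open>The \<open>l\<close>-th column of the inverse solves M x = e_l, so Cramer's rule
  applies. Its use is qualitative: the entries of the inverse are rational functions of those of
  \<open>M\<close>, hence differentiable.\<close>

lemma matrix_inv_cramer:
  assumes "invertible (M :: real^'n^'n)"
  shows "matrix_inv M $ k $ l = det (\<chi> i j. if j = k then axis l 1 $ i else M $ i $ j) / det M"
proof -
  have "M *v column l (matrix_inv M) = axis l 1"
    using matrix_inv_inverse(1)[OF assms]
    by (metis matrix_vector_mul_assoc matrix_vector_mul_lid matrix_vector_mult_basis)
  then have "column l (matrix_inv M) =
      (\<chi> k. det (\<chi> i j. if j = k then axis l 1 $ i else M $ i $ j) / det M)"
    using cramer[of M] assms invertible_det_nz by blast
  then show ?thesis by (simp add: column_def vec_eq_iff)
qed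

lemma differentiable_matrix_inv:
  fixes M :: "'e::real_normed_vector \<Rightarrow> real^'n^'n"
  assumes "open S" "x \<in> S" "\<And>y. y \<in> S \<Longrightarrow> invertible (M y)" "M differentiable (at x)"
  shows "(\<lambda>y. matrix_inv (M y)) differentiable (at x)"
proof (intro differentiable_vecI)
  fix k l
  have *: "(\<lambda>x. M x $ i $ j) differentiable (at x)" for i j
    using assms(4) by (intro differentiable_vec_nth)
  let ?q = "\<lambda>y. det (\<chi> i j. if j = k then axis l 1 $ i else M y $ i $ j) / det (M y)"
  have "?q differentiable (at x)"
  proof (intro differentiable_divide differentiable_det)
    show "det (M x) \<noteq> 0" using assms(2,3) invertible_det_nz by blast
    show "(\<lambda>x. (\<chi> i j. if j = k then axis l 1 $ i else M x $ i $ j) $ i $ j) differentiable (at x)"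
      for i j using * by (cases "j = k") simp_all
  qed (rule *)
  then obtain D where "(?q has_derivative D) (at x)" unfolding differentiable_def by blast
  then have "((\<lambda>y. matrix_inv (M y) $ k $ l) has_derivative D) (at x)"
    by (rule has_derivative_transform_within_open[OF _ assms(1,2)])
       (simp add: matrix_inv_cramer assms(3))
  then show "(\<lambda>y. matrix_inv (M y) $ k $ l) differentiable (at x)"
    by (auto simp: differentiable_def)
qed

text \<open>Once the inverse is known to be differentiable, its derivative is forced by
  differentiating \<open>M y ** matrix_inv (M y) = mat 1\<close>; no determinant has to be
  differentiated explicitly.\<close>

lemma has_derivative_matrix_inv:
  fixes M :: "'e::real_normed_vector \<Rightarrow> real^'n^'n"
  assumes "open S" "x \<in> S" "\<And>y. y \<in> S \<Longrightarrow> invertible (M y)" "(M has_derivative M') (at x)"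
  shows "((\<lambda>y. matrix_inv (M y)) has_derivative
    (\<lambda>h. - (matrix_inv (M x) ** (M' h ** matrix_inv (M x))))) (at x)"
proof -
  let ?H = "\<lambda>y. matrix_inv (M y)"
  have "M differentiable (at x)" using assms(4) by (auto simp: differentiable_def)
  then obtain H' where H': "(?H has_derivative H') (at x)"
    using differentiable_matrix_inv[where M=M, OF assms(1-3)] unfolding differentiable_def by blast
  have "((\<lambda>y. M y ** ?H y) has_derivative (\<lambda>h. M x ** H' h + M' h ** ?H x)) (at x)"
    by (rule has_derivative_matrix_matrix_mult[OF assms(4) H'])
  moreover have "((\<lambda>y. M y ** ?H y) has_derivative (\<lambda>h. 0)) (at x)"
    by (rule has_derivative_transform_within_open[OF has_derivative_const[of "mat 1"] assms(1,2)])
       (simp add: matrix_inv_inverse assms(3))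
  ultimately have "(\<lambda>h. M x ** H' h + M' h ** ?H x) = (\<lambda>h. 0)"
    by (rule has_derivative_unique)
  then have z: "M x ** H' h + M' h ** ?H x = 0" for h
    by (simp add: fun_eq_iff)
  have "H' h = - (?H x ** (M' h ** ?H x))" for h
  proof -
    have "?H x ** (M x ** H' h + M' h ** ?H x) = 0" by (simp add: z)
    then have "H' h + ?H x ** (M' h ** ?H x) = 0"
      by (simp add: matrix_add_ldistrib matrix_mul_assoc matrix_inv_inverse assms(2,3))
    then show ?thesis by (simp add: eq_neg_iff_add_eq_0)
  qed
  then have "H' = (\<lambda>h. - (?H x ** (M' h ** ?H x)))" by blast
  with H' show ?thesis by simp
qed

section \<open>The coordinate divergence and its invariance\<close>

lemma linear_eq_sum_axis:
  fixes L :: "real^'n \<Rightarrow> real"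
  assumes "linear L"
  shows "L v = (\<Sum>i\<in>UNIV. L (axis i 1) * v $ i)"
proof -
  have "v = (\<Sum>i\<in>UNIV. v $ i *\<^sub>R axis i 1)"
    using basis_expansion[of v] by (simp add: scalar_mult_eq_scaleR)
  then have "L v = L (\<Sum>i\<in>UNIV. v $ i *\<^sub>R axis i 1)" by simp
  also have "\<dots> = (\<Sum>i\<in>UNIV. v $ i * L (axis i 1))"
    by (simp add: linear_sum[OF assms] linear_cmul[OF assms])
  finally show ?thesis by (simp add: mult.commute)
qed

lemma trace_matrix: "trace (matrix L :: real^'n^'n) = (\<Sum>i\<in>UNIV. L (axis i 1) $ i)"
  by (simp add: trace_def matrix_def)

text \<open>The second summand is the derivative of \<open>log (sqrt (det G))\<close> along \<open>X\<close>, so this is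
  the divergence of the vector field with components \<open>X\<close> for the metric with matrix \<open>G\<close>.\<close>

definition coord_div ::
    "(real^'n \<Rightarrow> real^'n^'n) \<Rightarrow> (real^'n \<Rightarrow> real^'n) \<Rightarrow> real^'n \<Rightarrow> real" where
  "coord_div G X x = trace (matrix (frechet_derivative X (at x)))
     + trace (matrix_inv (G x) ** frechet_derivative G (at x) (X x)) / 2"

lemma coord_div_eq:
  assumes "(X has_derivative X') (at x)" "(G has_derivative G') (at x)"
  shows "coord_div G X x = trace (matrix X') + trace (matrix_inv (G x) ** G' (X x)) / 2"
  by (simp add: coord_div_def frechet_derivative_eqI[OF assms(1)] frechet_derivative_eqI[OF assms(2)])

lemma matrix_inv_unique:
  assumes "(M :: real^'n^'n) ** N = mat 1"
  shows "matrix_inv M = N"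
proof -
  have "invertible M" using assms by (simp add: invertible_right_inverse) blast
  then have "matrix_inv M ** (M ** N) = N"
    by (simp add: matrix_mul_assoc matrix_inv_inverse)
  then show ?thesis by (simp add: assms)
qed

text \<open>The derivative of \<open>J\<close> contributes to the first trace and, through
  \<open>Gc = J\<^sup>T (Gd \<circ> T) J\<close>, with the opposite sign to the second one, by the symmetry of the
  second derivative of \<open>T\<close>.\<close>

lemma coord_div_invariant:
  fixes T :: "real^'n \<Rightarrow> real^'n" and J :: "real^'n \<Rightarrow> real^'n^'n"
  assumes "open S" "x \<in> S"
    and T: "(T has_derivative (\<lambda>v. J x *v v)) (at x)"
    and J: "(J has_derivative J') (at x)"
    and sym: "\<And>v w. J' v *v w = J' w *v v"
    and Xc: "(Xc has_derivative Xc') (at x)"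
    and Xd: "(Xd has_derivative Xd') (at (T x))"
    and Gd: "(Gd has_derivative Gd') (at (T x))"
    and X: "\<And>y. y \<in> S \<Longrightarrow> Xd (T y) = J y *v Xc y"
    and G: "\<And>y. y \<in> S \<Longrightarrow> Gc y = transpose (J y) ** (Gd (T y) ** J y)"
    and inv: "invertible (J x)" "invertible (Gd (T x))"
  shows "coord_div Gc Xc x = coord_div Gd Xd (T x)"
proof -
  define K where "K = matrix_inv (J x)"
  define H where "H = matrix_inv (Gd (T x))"
  define Z where "Z = Xc x"
  note KJ = matrix_inv_inverse[OF inv(1), folded K_def]
  note HG = matrix_inv_inverse[OF inv(2), folded H_def]
  have JKm: "J x ** (K ** M) = M" for M :: "real^'n^'n"
    by (simp add: matrix_mul_assoc KJ)
  have HGm: "H ** (Gd (T x) ** M) = M" and GHm: "Gd (T x) ** (H ** M) = M" for M :: "real^'n^'n"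
    by (simp_all add: matrix_mul_assoc HG)
  have tK: "transpose (J x) ** transpose K = mat 1" "transpose K ** transpose (J x) = mat 1"
    by (simp_all flip: matrix_transpose_mul add: KJ)
  have tKm: "transpose (J x) ** (transpose K ** M) = M" "transpose K ** (transpose (J x) ** M) = M"
    for M :: "real^'n^'n"
    by (simp_all add: matrix_mul_assoc tK)

  have "((\<lambda>y. Xd (T y)) has_derivative (\<lambda>v. Xd' (J x *v v))) (at x)"
    by (rule has_derivative_compose[OF T Xd])
  moreover have "((\<lambda>y. Xd (T y)) has_derivative (\<lambda>v. J x *v Xc' v + J' v *v Z)) (at x)"
    unfolding Z_def
    by (rule has_derivative_transform_within_open[OF has_derivative_matrix_vector_mult[OF J Xc] assms(1,2)])
       (simp add: X)
  ultimately have "(\<lambda>v. Xd' (J x *v v)) = (\<lambda>v. J x *v Xc' v + J' v *v Z)"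
    by (rule has_derivative_unique)
  \<comment> \<open>\<open>sym\<close> turns \<open>J' v *v Z\<close> into \<open>J' Z *v v\<close>,
    the action of one fixed matrix on \<open>v\<close>, so that the identity can be read as one
    between matrices.\<close>
  then have eqX: "Xd' (J x *v v) = J x *v Xc' v + J' Z *v v" for v
    using sym[of Z v] by (simp add: fun_eq_iff)
  have linX: "linear Xc'" "linear Xd'" using Xc Xd has_derivative_linear by blast+
  have "matrix Xd' ** J x = J x ** matrix Xc' + J' Z"
  proof (rule matrix_eq[THEN iffD2], intro allI)
    fix v
    show "(matrix Xd' ** J x) *v v = (J x ** matrix Xc' + J' Z) *v v"
      using eqX[of v]
      by (simp add: matrix_vector_mul_assoc[symmetric] matrix_works linX matrix_vector_mult_add_rdistrib)
  qed
  \<comment> \<open>Multiplying by the inverse Jacobian on the right conjugates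
    \<open>matrix Xc'\<close>, which preserves its trace; only the trace of \<open>J' Z ** K\<close>
    remains as a correction.\<close>
  then have "matrix Xd' ** (J x ** K) = (J x ** matrix Xc' + J' Z) ** K"
    by (simp add: matrix_mul_assoc)
  then have "matrix Xd' = J x ** (matrix Xc' ** K) + J' Z ** K"
    by (simp add: KJ matrix_add_rdistrib matrix_mul_assoc)
  then have tX: "trace (matrix Xd') = trace (matrix Xc') + trace (J' Z ** K)"
    by (simp add: trace_add trace_mul_sym[of "J x"] KJ flip: matrix_mul_assoc)

  have "((\<lambda>y. Gd (T y)) has_derivative (\<lambda>v. Gd' (J x *v v))) (at x)"
    by (rule has_derivative_compose[OF T Gd])
  note 1 = has_derivative_matrix_matrix_mult[OF this J]
  note 2 = has_derivative_matrix_matrix_mult[OF bounded_linear.has_derivative[OF bounded_linear_transpose J] this]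
  have Gc: "(Gc has_derivative (\<lambda>v. transpose (J x) ** (Gd (T x) ** J' v + Gd' (J x *v v) ** J x)
      + transpose (J' v) ** (Gd (T x) ** J x))) (at x)"
    by (rule has_derivative_transform_within_open[OF 2 assms(1,2)]) (simp add: G)
  have Hc: "matrix_inv (Gc x) = K ** (H ** transpose K)"
    by (rule matrix_inv_unique)
       (simp add: G assms(2) JKm GHm tK flip: matrix_mul_assoc)
  have XZ: "Xd (T x) = J x *v Z" using X assms(2) by (simp add: Z_def)
  \<comment> \<open>The product rule for \<open>Gc\<close> gives three summands. Those where a
    Jacobian factor is differentiated (\<open>a\<close> and \<open>c\<close>) contribute the same
    trace; the factor 1/2 in \<open>coord_div\<close> reduces the two copies to one, exactly the
    correction in \<open>tX\<close>.\<close>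
  have a: "trace (K ** (H ** transpose K) ** (transpose (J x) ** (Gd (T x) ** J' Z)))
      = trace (J' Z ** K)"
    by (simp add: tKm HGm trace_mul_sym[of K] flip: matrix_mul_assoc)
  have b: "trace (K ** (H ** transpose K) ** (transpose (J x) ** (Gd' (J x *v Z) ** J x)))
      = trace (H ** Gd' (J x *v Z))"
    by (simp add: tKm trace_mul_sym[of K] KJ flip: matrix_mul_assoc)
  have c: "trace (K ** (H ** transpose K) ** (transpose (J' Z) ** (Gd (T x) ** J x)))
      = trace (J' Z ** K)"
  proof -
    have "trace (K ** (H ** transpose K) ** (transpose (J' Z) ** (Gd (T x) ** J x)))
        = trace ((H ** (transpose K ** (transpose (J' Z) ** Gd (T x)))))"
      by (simp add: trace_mul_sym[of K] KJ flip: matrix_mul_assoc)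
    also have "\<dots> = trace (transpose K ** transpose (J' Z))"
      by (simp add: trace_mul_sym[of H] HG flip: matrix_mul_assoc)
    also have "\<dots> = trace (transpose (J' Z ** K))" by (simp add: matrix_transpose_mul)
    also have "\<dots> = trace (J' Z ** K)" by (simp add: trace_def transpose_def)
    finally show ?thesis .
  qed
  have "trace (matrix_inv (Gc x) ** (transpose (J x) ** (Gd (T x) ** J' Z + Gd' (J x *v Z) ** J x)
      + transpose (J' Z) ** (Gd (T x) ** J x))) = 2 * trace (J' Z ** K) + trace (H ** Gd' (J x *v Z))"
    unfolding Hc matrix_add_ldistrib trace_add a b c by simp
  then show ?thesis
    unfolding coord_div_eq[OF Xc Gc] coord_div_eq[OF Xd Gd] XZ tX H_def[symmetric] Z_def[symmetric]
    by simp
qed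

section \<open>The Laplacian as a second-order operator in coordinates\<close>

text \<open>For a metric matrix with inverse entries g^ij this is the first-order coefficient of the
  Laplace-Beltrami operator, (sum_i d_i (sqrt(det G) g^ij)) / sqrt(det G). The first sum is the
  derivative of the inverse metric, the second one the derivative of log sqrt(det G).\<close>

definition lap_drift :: "(real^'n \<Rightarrow> real^'n^'n) \<Rightarrow> 'n \<Rightarrow> real^'n \<Rightarrow> real" where
  "lap_drift G j x =
     (\<Sum>i\<in>UNIV. (- (matrix_inv (G x) **
        (frechet_derivative G (at x) (axis i 1) ** matrix_inv (G x)))) $ i $ j)
     + trace (matrix_inv (G x) **
        (\<Sum>k\<in>UNIV. matrix_inv (G x) $ k $ j *\<^sub>R frechet_derivative G (at x) (axis k 1))) / 2"

text \<open>By the product rule the derivative falls either on the covector field \<open>D\<close>,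
  which gives the principal part, or on the metric, which gives terms linear in \<open>D x\<close>.
  The coefficients then depend on \<open>G\<close> alone, as a linear operator requires.\<close>

lemma coord_div_gradient:
  fixes G :: "real^'n \<Rightarrow> real^'n^'n"
  assumes "open S" "x \<in> S" and inv: "\<And>y. y \<in> S \<Longrightarrow> invertible (G y)"
    and G: "G differentiable (at x)"
    and D: "(D has_derivative D') (at x)"
  shows "((\<lambda>y. matrix_inv (G y) *v D y) has_derivative
      (\<lambda>h. matrix_inv (G x) *v D' h
        + (- (matrix_inv (G x) ** (frechet_derivative G (at x) h ** matrix_inv (G x)))) *v D x)) (at x)"
      (is ?d)
    and "coord_div G (\<lambda>y. matrix_inv (G y) *v D y) x =
      (\<Sum>i\<in>UNIV. \<Sum>j\<in>UNIV. matrix_inv (G x) $ i $ j * D' (axis i 1) $ j)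
      + (\<Sum>j\<in>UNIV. lap_drift G j x * D x $ j)"
proof -
  let ?G' = "frechet_derivative G (at x)" and ?H = "matrix_inv (G x)"
  have G': "(G has_derivative ?G') (at x)" using G by (simp add: frechet_derivative_works)
  show d: ?d
    by (rule has_derivative_matrix_vector_mult[OF has_derivative_matrix_inv[OF assms(1,2) inv G'] D])
  have lin: "linear ?G'" using G' by (rule has_derivative_linear)
  \<comment> \<open>Expanding the direction along the axes makes the log-determinant term visibly
    linear in the components of \<open>D x\<close>.\<close>
  have H: "?H *v D x = (\<Sum>k\<in>UNIV. (\<Sum>j\<in>UNIV. ?H $ k $ j * D x $ j) *\<^sub>R axis k 1)"
    by (simp add: vec_eq_iff matrix_vector_mult_def axis_def if_distrib cong: if_cong)
  have "?G' (?H *v D x) = (\<Sum>j\<in>UNIV. D x $ j *\<^sub>R (\<Sum>k\<in>UNIV. ?H $ k $ j *\<^sub>R ?G' (axis k 1)))"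
    unfolding H linear_sum[OF lin] linear_cmul[OF lin] scaleR_sum_left scaleR_sum_right
    by (subst sum.swap) (simp add: mult.commute)
  then have 1: "trace (?H ** ?G' (?H *v D x))
      = (\<Sum>j\<in>UNIV. trace (?H ** (\<Sum>k\<in>UNIV. ?H $ k $ j *\<^sub>R ?G' (axis k 1))) * D x $ j)"
    by (simp add: bounded_bilinear.sum_right[OF bounded_bilinear_matrix_matrix_mult]
        linear_sum[OF bounded_linear.linear[OF bounded_linear_trace]]
        bounded_bilinear.scaleR_right[OF bounded_bilinear_matrix_matrix_mult]
        linear_cmul[OF bounded_linear.linear[OF bounded_linear_trace]] mult.commute)
  let ?M = "\<lambda>i. - (?H ** (?G' (axis i 1) ** ?H))"
  have 2: "(\<Sum>i\<in>UNIV. (?M i *v D x) $ i) = (\<Sum>j\<in>UNIV. (\<Sum>i\<in>UNIV. ?M i $ i $ j) * D x $ j)"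
    unfolding matrix_vector_mult_def sum_distrib_right vec_lambda_beta by (rule sum.swap)
  show "coord_div G (\<lambda>y. matrix_inv (G y) *v D y) x =
      (\<Sum>i\<in>UNIV. \<Sum>j\<in>UNIV. ?H $ i $ j * D' (axis i 1) $ j)
      + (\<Sum>j\<in>UNIV. lap_drift G j x * D x $ j)"
    unfolding coord_div_eq[OF d G'] trace_matrix lap_drift_def vector_add_component sum.distrib
      distrib_right 1 2
    by (simp add: matrix_vector_mult_def sum_divide_distrib)
qed

lemma continuous_on_lap_drift:
  fixes G :: "real^'n \<Rightarrow> real^'n^'n"
  assumes "continuous_on S (\<lambda>x. matrix_inv (G x))"
    and "\<And>v. continuous_on S (\<lambda>x. frechet_derivative G (at x) v)"
  shows "continuous_on S (lap_drift G j)"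
  unfolding lap_drift_def
  by (intro continuous_intros assms continuous_on_component
      bounded_bilinear.continuous_on[OF bounded_bilinear_matrix_matrix_mult]
      bounded_linear.continuous_on[OF bounded_linear_trace]) auto

subsection \<open>The strong maximum principle\<close>

text \<open>Gaussian elimination instead of diagonalisation: each induction step splits off from
  \<open>a\<close> the rank-one form built from its \<open>k\<close>-th row. The remainder is
  positive definite on fewer indices, and the rank-one part pairs with \<open>m\<close> to a value
  of the form of \<open>m\<close>.\<close>

lemma sum_posdef_negsemidef_nonpos:
  fixes a m :: "'i \<Rightarrow> 'i \<Rightarrow> real"
  assumes "finite I" "\<And>i j. a i j = a j i"
    and "\<And>v. (\<exists>i\<in>I. v i \<noteq> 0) \<Longrightarrow> (\<Sum>i\<in>I. \<Sum>j\<in>I. a i j * v i * v j) > 0"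
    and "\<And>v. (\<Sum>i\<in>I. \<Sum>j\<in>I. m i j * v i * v j) \<le> 0"
  shows "(\<Sum>i\<in>I. \<Sum>j\<in>I. a i j * m i j) \<le> 0"
  using assms
proof (induction I arbitrary: a)
  case empty
  then show ?case by simp
next
  case (insert k I)
  have split: "(\<Sum>i\<in>insert k I. \<Sum>j\<in>insert k I. q i j) =
      q k k + (\<Sum>i\<in>I. q k i + q i k) + (\<Sum>i\<in>I. \<Sum>j\<in>I. q i j)" for q :: "'i \<Rightarrow> 'i \<Rightarrow> real"
    using insert.hyps by (simp add: sum.distrib)
  \<comment> \<open>The unit vector at \<open>k\<close>, used to see that the pivot
    \<open>a k k\<close> is positive.\<close>
  define e :: "'i \<Rightarrow> real" where "e i = (if i = k then 1 else 0)" for i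
  have eI: "e i = 0" if "i \<in> I" for i using insert.hyps that by (auto simp: e_def)
  have "e k = 1" by (simp add: e_def)
  then have akk: "a k k > 0"
    using insert.prems(2)[of e] unfolding split by (simp add: eI)
  \<comment> \<open>The Schur complement of the pivot.\<close>
  define a' where "a' i j = a i j - a k i * a k j / a k k" for i j
  have "(\<Sum>i\<in>I. \<Sum>j\<in>I. a' i j * m i j) \<le> 0"
  proof (rule insert.IH)
    show "a' i j = a' j i" for i j
      using insert.prems(1)[of i j] by (simp add: a'_def)
    show "(\<Sum>i\<in>I. \<Sum>j\<in>I. m i j * v i * v j) \<le> 0" for v
    proof -
      have *: "\<And>i. i \<in> I \<Longrightarrow> i \<noteq> k" using insert.hyps by blast
      have "(\<Sum>i\<in>I. \<Sum>j\<in>I. m i j * (v(k := 0)) i * (v(k := 0)) j) = (\<Sum>i\<in>I. \<Sum>j\<in>I. m i j * v i * v j)"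
        using * by (intro sum.cong) auto
      then show ?thesis
        using insert.prems(3)[of "v(k := 0)"] unfolding split by simp
    qed
    fix v :: "'i \<Rightarrow> real" assume "\<exists>i\<in>I. v i \<noteq> 0"
    define S where "S = (\<Sum>j\<in>I. a k j * v j)"
    \<comment> \<open>This value at \<open>k\<close> minimises the form of \<open>a\<close> among
      all extensions of \<open>v\<close> from \<open>I\<close>; the minimum is the form of the Schur
      complement at \<open>v\<close>.\<close>
    define w where "w = v(k := - S / a k k)"
    have wI: "w i = v i" if "i \<in> I" for i using insert.hyps that by (auto simp: w_def)
    have wk: "w k = - S / a k k" by (simp add: w_def)
    have "\<exists>i\<in>insert k I. w i \<noteq> 0"
      using \<open>\<exists>i\<in>I. v i \<noteq> 0\<close> wI by auto
    then have "(\<Sum>i\<in>insert k I. \<Sum>j\<in>insert k I. a i j * w i * w j) > 0"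
      by (rule insert.prems(2))
    moreover have "(\<Sum>i\<in>I. a k i * w k * w i + a i k * w i * w k) = 2 * w k * S"
      using wI insert.prems(1) by (simp add: S_def sum_distrib_left algebra_simps)
    moreover have "(\<Sum>i\<in>I. \<Sum>j\<in>I. a i j * w i * w j) = (\<Sum>i\<in>I. \<Sum>j\<in>I. a i j * v i * v j)"
      using wI by simp
    moreover have "a k k * w k * w k = S * S / a k k" "2 * w k * S = - 2 * (S * S / a k k)"
      using akk by (simp_all add: wk)
    moreover have "S * S / a k k = (\<Sum>i\<in>I. \<Sum>j\<in>I. a k i * a k j / a k k * v i * v j)"
      unfolding S_def sum_product sum_divide_distrib by (intro sum.cong) simp_all
    moreover have "(\<Sum>i\<in>I. \<Sum>j\<in>I. a' i j * v i * v j) = (\<Sum>i\<in>I. \<Sum>j\<in>I. a i j * v i * v j)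
        - (\<Sum>i\<in>I. \<Sum>j\<in>I. a k i * a k j / a k k * v i * v j)"
      by (simp add: a'_def left_diff_distrib sum_subtractf)
    ultimately show "(\<Sum>i\<in>I. \<Sum>j\<in>I. a' i j * v i * v j) > 0"
      unfolding split by linarith
  qed
  moreover have "(\<Sum>i\<in>insert k I. \<Sum>j\<in>insert k I. m i j * a k i * a k j) / a k k \<le> 0"
    using insert.prems(3) akk by (intro divide_nonpos_pos)
  moreover have "(\<Sum>i\<in>insert k I. \<Sum>j\<in>insert k I. a i j * m i j) =
      (\<Sum>i\<in>I. \<Sum>j\<in>I. a' i j * m i j)
      + (\<Sum>i\<in>insert k I. \<Sum>j\<in>insert k I. m i j * a k i * a k j) / a k k"
  proof -
    have "(\<Sum>i\<in>I. a k i * m k i + a i k * m i k)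
        = (\<Sum>i\<in>I. m k i * a k k * a k i + m i k * a k i * a k k) / a k k"
      unfolding sum_divide_distrib
    proof (intro sum.cong refl)
      fix i
      show "a k i * m k i + a i k * m i k = (m k i * a k k * a k i + m i k * a k i * a k k) / a k k"
        using akk by (simp add: insert.prems(1)[of i k] field_simps)
    qed
    moreover have "(\<Sum>i\<in>I. \<Sum>j\<in>I. a i j * m i j) = (\<Sum>i\<in>I. \<Sum>j\<in>I. a' i j * m i j)
        + (\<Sum>i\<in>I. \<Sum>j\<in>I. m i j * a k i * a k j) / a k k"
    proof -
      have "(\<Sum>i\<in>I. \<Sum>j\<in>I. a' i j * m i j) = (\<Sum>i\<in>I. \<Sum>j\<in>I. a i j * m i j)
          - (\<Sum>i\<in>I. \<Sum>j\<in>I. a k i * a k j / a k k * m i j)"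
        by (simp add: a'_def left_diff_distrib sum_subtractf)
      also have "(\<Sum>i\<in>I. \<Sum>j\<in>I. a k i * a k j / a k k * m i j)
          = (\<Sum>i\<in>I. \<Sum>j\<in>I. m i j * a k i * a k j) / a k k"
        unfolding sum_divide_distrib by (intro sum.cong) simp_all
      finally show ?thesis by simp
    qed
    ultimately show ?thesis
      unfolding split add_divide_distrib using akk by simp
  qed
  ultimately show ?case by linarith
qed

text \<open>If the Hessian form were positive at \<open>v\<close>, the derivative \<open>p\<close>
  along the line through \<open>q\<close> would vanish at 0 and be positive just after it, so the
  mean value theorem would give a value above the maximum.\<close>

lemma local_max_derivatives:
  fixes f :: "real^'n \<Rightarrow> real"
  assumes "r > 0" and max: "\<And>y. y \<in> ball q r \<Longrightarrow> f y \<le> f q"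
    and f1: "\<And>y. y \<in> ball q r \<Longrightarrow> (f has_derivative (\<lambda>v. \<Sum>i\<in>UNIV. f1 i y * v $ i)) (at y)"
    and f2: "\<And>i. (f1 i has_derivative (\<lambda>v. \<Sum>j\<in>UNIV. f2 i j * v $ j)) (at q)"
  shows "f1 i q = 0" "(\<Sum>i\<in>UNIV. \<Sum>j\<in>UNIV. f2 i j * v $ i * v $ j) \<le> 0"
proof -
  have "(\<lambda>v. \<Sum>i\<in>UNIV. f1 i q * v $ i) = (\<lambda>v. 0)"
    by (rule differential_zero_maxmin[of q "ball q r" f]) (use f1[of q] \<open>r > 0\<close> max in auto)
  from fun_cong[OF this, of "axis j 1" for j] have z: "f1 j q = 0" for j
    by (simp add: axis_def if_distrib cong: if_cong)
  then show "f1 i q = 0" .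
  show "(\<Sum>i\<in>UNIV. \<Sum>j\<in>UNIV. f2 i j * v $ i * v $ j) \<le> 0"
  proof (rule ccontr)
    define s where "s = r / (norm v + 1)"
    have nv: "norm v + 1 > 0" by (simp add: add_nonneg_pos)
    have "s > 0" using \<open>r > 0\<close> nv by (simp add: s_def)
    have inball: "q + t *\<^sub>R v \<in> ball q r" if "0 \<le> t" "t < s" for t
    proof -
      have "t * norm v \<le> t * (norm v + 1)" using that by (simp add: algebra_simps)
      also have "\<dots> < s * (norm v + 1)" using that nv by (intro mult_strict_right_mono)
      also have "\<dots> = r" using nv by (simp add: s_def)
      finally show ?thesis using that by (simp add: dist_norm)
    qed
    define p where "p t = (\<Sum>i\<in>UNIV. f1 i (q + t *\<^sub>R v) * v $ i)" for t
    have dF: "((\<lambda>t. f (q + t *\<^sub>R v)) has_real_derivative p t) (at t)" if "0 \<le> t" "t < s" for t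
      unfolding has_real_derivative_iff_has_vector_derivative p_def
      by (intro has_derivative_along_line f1 inball that)
    let ?P = "\<Sum>i\<in>UNIV. \<Sum>j\<in>UNIV. f2 i j * v $ i * v $ j"
    have "((\<lambda>t. f1 i (q + t *\<^sub>R v)) has_real_derivative (\<Sum>j\<in>UNIV. f2 i j * v $ j)) (at 0)" for i
      unfolding has_real_derivative_iff_has_vector_derivative
      by (intro has_derivative_along_line) (simp add: f2)
    then have "(p has_real_derivative (\<Sum>i\<in>UNIV. (\<Sum>j\<in>UNIV. f2 i j * v $ j) * v $ i)) (at 0)"
      unfolding p_def by (intro DERIV_sum DERIV_cmult_right)
    also have "(\<Sum>i\<in>UNIV. (\<Sum>j\<in>UNIV. f2 i j * v $ j) * v $ i) = ?P"
      unfolding sum_distrib_right by (intro sum.cong) simp_all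
    finally have dp: "(p has_real_derivative ?P) (at 0)" .
    assume "\<not> ?P \<le> 0"
    then obtain d where d: "d > 0" "\<And>h. h > 0 \<Longrightarrow> h < d \<Longrightarrow> p 0 < p (0 + h)"
      using DERIV_pos_inc_right[OF dp] by auto
    have p0: "p 0 = 0" by (simp add: p_def z)
    define t where "t = min d s / 2"
    have t: "0 < t" "t < d" "t < s" using d \<open>s > 0\<close> by (auto simp: t_def)
    obtain u where u: "0 < u" "u < t" "f (q + t *\<^sub>R v) - f (q + 0 *\<^sub>R v) = (t - 0) * p u"
      using MVT2[OF t(1), of "\<lambda>t. f (q + t *\<^sub>R v)" p] dF t by auto
    have "p u > 0" using d(2)[of u] u t p0 by simp
    then have "t * p u > 0" using t(1) by simp
    then have "f (q + t *\<^sub>R v) > f q" using u by simp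
    then show False using max[OF inball[of t]] t by simp
  qed
qed

text \<open>The partial derivatives are arguments in their own right, tied to a function only by
  \<open>has_derivative\<close> facts, so linearity of the operator is pure algebra. There is no
  zeroth-order term: constants are annihilated.\<close>

definition elliptic_op where
  "elliptic_op a b f1 f2 x =
     (\<Sum>i\<in>UNIV. \<Sum>j\<in>UNIV. a i j x * f2 i j x) + (\<Sum>i\<in>UNIV. b i x * f1 i (x :: real^'n) :: real)"

text \<open>Positivity is only pointwise; the uniform bounds behind Hopf's argument come from
  compactness in \<open>barrier_exists\<close>.\<close>

locale elliptic =
  fixes U :: "(real^'n) set" and a :: "'n \<Rightarrow> 'n \<Rightarrow> real^'n \<Rightarrow> real" and b :: "'n \<Rightarrow> real^'n \<Rightarrow> real"
  assumes open_U: "open U"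
    and a_continuous: "continuous_on U (a i j)"
    and b_continuous: "continuous_on U (b i)"
    and a_sym: "x \<in> U \<Longrightarrow> a i j x = a j i x"
    and a_posdef: "x \<in> U \<Longrightarrow> v \<noteq> 0 \<Longrightarrow> (\<Sum>i\<in>UNIV. \<Sum>j\<in>UNIV. a i j x * v $ i * v $ j) > 0"
begin

text \<open>At a maximum the gradient terms drop out and the Hessian is negative semidefinite. Hence
  a function on which the operator is positive has no interior maximum.\<close>

lemma local_max_elliptic_op_nonpos:
  assumes "q \<in> U" "r > 0" and "\<And>y. y \<in> ball q r \<Longrightarrow> f y \<le> f q"
    and "\<And>y. y \<in> ball q r \<Longrightarrow> (f has_derivative (\<lambda>v. \<Sum>i\<in>UNIV. f1 i y * v $ i)) (at y)"
    and "\<And>i. (f1 i has_derivative (\<lambda>v. \<Sum>j\<in>UNIV. f2 i j q * v $ j)) (at q)"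
  shows "elliptic_op a b f1 f2 q \<le> 0"
proof -
  have der1: "f1 i q = 0" for i by (rule local_max_derivatives(1)[OF assms(2-5)])
  have der2: "(\<Sum>i\<in>UNIV. \<Sum>j\<in>UNIV. f2 i j q * v $ i * v $ j) \<le> 0" for v
    by (rule local_max_derivatives(2)[OF assms(2-5)])
  have "(\<Sum>i\<in>UNIV. \<Sum>j\<in>UNIV. a i j q * f2 i j q) \<le> 0"
  proof (rule sum_posdef_negsemidef_nonpos)
    show "a i j q = a j i q" for i j using a_sym assms(1) by blast
    show "(\<Sum>i\<in>UNIV. \<Sum>j\<in>UNIV. f2 i j q * v i * v j) \<le> 0" for v
      using der2[of "vec_lambda v"] by simp
    show "(\<Sum>i\<in>UNIV. \<Sum>j\<in>UNIV. a i j q * v i * v j) > 0" if "\<exists>i\<in>UNIV. v i \<noteq> 0" for v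
      using a_posdef[OF assms(1), of "vec_lambda v"] that by (auto simp: vec_eq_iff)
  qed simp
  then show ?thesis by (simp add: elliptic_op_def der1)
qed

section \<open>Hopf's barrier\<close>

text \<open>Hopf's auxiliary function with centre \<open>y\<close> and steepness \<open>c\<close>,
  without the customary additive constant, since only comparisons of values and derivatives are
  used. \<open>barrier1\<close> and \<open>barrier2\<close> are its partial derivatives.\<close>

definition barrier :: "real \<Rightarrow> real^'n \<Rightarrow> real^'n \<Rightarrow> real" where
  "barrier c y x = exp (- c * ((x - y) \<bullet> (x - y)))"

definition barrier1 :: "real \<Rightarrow> real^'n \<Rightarrow> 'n \<Rightarrow> real^'n \<Rightarrow> real" where
  "barrier1 c y i x = - 2 * c * (x - y) $ i * barrier c y x"

definition barrier2 :: "real \<Rightarrow> real^'n \<Rightarrow> 'n \<Rightarrow> 'n \<Rightarrow> real^'n \<Rightarrow> real" where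
  "barrier2 c y i j x =
     (4 * c\<^sup>2 * (x - y) $ i * (x - y) $ j - 2 * c * (if i = j then 1 else 0)) * barrier c y x"

lemma has_derivative_barrier:
  "(barrier c y has_derivative (\<lambda>v. \<Sum>i\<in>UNIV. barrier1 c y i x * v $ i)) (at x)"
proof -
  have "(barrier c y has_derivative (\<lambda>v. barrier c y x * (- c * (2 * ((x - y) \<bullet> v))))) (at x)"
    unfolding barrier_def
    by (auto intro!: derivative_eq_intros simp: inner_commute algebra_simps)
  moreover have "barrier c y x * (- c * (2 * ((x - y) \<bullet> v))) = (\<Sum>i\<in>UNIV. barrier1 c y i x * v $ i)" for v
    by (simp add: inner_vec_def barrier1_def sum_distrib_left algebra_simps)
  ultimately show ?thesis by simp
qed

lemma has_derivative_barrier1: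
  "(barrier1 c y i has_derivative (\<lambda>v. \<Sum>j\<in>UNIV. barrier2 c y i j x * v $ j)) (at x)"
proof -
  have 1: "((\<lambda>x. - 2 * c * (x - y) $ i) has_derivative (\<lambda>v. - 2 * c * v $ i)) (at x)"
    by (intro has_derivative_mult_right has_derivative_vec_nth) (auto intro!: derivative_eq_intros)
  have "(barrier1 c y i has_derivative
      (\<lambda>v. - 2 * c * (x - y) $ i * (\<Sum>j\<in>UNIV. barrier1 c y j x * v $ j)
        + - 2 * c * v $ i * barrier c y x)) (at x)"
    using has_derivative_mult[OF 1 has_derivative_barrier, of c y] by (simp add: barrier1_def[abs_def])
  moreover have "- 2 * c * (x - y) $ i * (\<Sum>j\<in>UNIV. barrier1 c y j x * v $ j)
        + - 2 * c * v $ i * barrier c y x = (\<Sum>j\<in>UNIV. barrier2 c y i j x * v $ j)" for v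
  proof -
    have "(\<Sum>j\<in>UNIV. barrier2 c y i j x * v $ j) =
        (\<Sum>j\<in>UNIV. - 2 * c * (x - y) $ i * (barrier1 c y j x * v $ j))
        + (\<Sum>j\<in>UNIV. if j = i then - 2 * c * v $ i * barrier c y x else 0)"
      unfolding sum.distrib[symmetric]
      by (intro sum.cong) (auto simp: barrier1_def barrier2_def power2_eq_square algebra_simps)
    then show ?thesis by (simp add: sum_distrib_left)
  qed
  ultimately show ?thesis by simp
qed

text \<open>Arranged by powers of \<open>c\<close>: away from the centre the quadratic term is
  positive by ellipticity, and the remaining terms are only linear in \<open>c\<close>, so a large
  \<open>c\<close> makes the whole positive.\<close>

lemma elliptic_op_barrier:
  "elliptic_op a b (barrier1 c y) (barrier2 c y) x = barrier c y x * (2 * c *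
     (2 * c * (\<Sum>i\<in>UNIV. \<Sum>j\<in>UNIV. a i j x * (x - y) $ i * (x - y) $ j)
      - ((\<Sum>i\<in>UNIV. a i i x) + (\<Sum>i\<in>UNIV. b i x * (x - y) $ i))))"
proof -
  have "(\<Sum>i\<in>UNIV. \<Sum>j\<in>UNIV. a i j x * barrier2 c y i j x) =
     (\<Sum>i\<in>UNIV. \<Sum>j\<in>UNIV. barrier c y x * (4 * c\<^sup>2) * (a i j x * (x - y) $ i * (x - y) $ j))
     + (\<Sum>i\<in>UNIV. \<Sum>j\<in>UNIV. if j = i then - 2 * c * barrier c y x * a i i x else 0)"
    unfolding sum.distrib[symmetric] by (intro sum.cong) (auto simp: barrier2_def algebra_simps)
  also have "\<dots> = barrier c y x * (4 * c\<^sup>2) * (\<Sum>i\<in>UNIV. \<Sum>j\<in>UNIV. a i j x * (x - y) $ i * (x - y) $ j)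
     - 2 * c * barrier c y x * (\<Sum>i\<in>UNIV. a i i x)"
    by (simp add: sum_distrib_left sum_negf)
  finally have 1: "(\<Sum>i\<in>UNIV. \<Sum>j\<in>UNIV. a i j x * barrier2 c y i j x) = \<dots>" .
  have 2: "(\<Sum>i\<in>UNIV. b i x * barrier1 c y i x)
      = - 2 * c * barrier c y x * (\<Sum>i\<in>UNIV. b i x * (x - y) $ i)"
    by (simp add: barrier1_def sum_distrib_left algebra_simps)
  show ?thesis unfolding elliptic_op_def 1 2
    by (simp add: algebra_simps power2_eq_square)
qed

lemma barrier_exists:
  assumes "compact B" "B \<subseteq> U" "y \<notin> B"
  shows "\<exists>c>0. \<forall>x\<in>B. elliptic_op a b (barrier1 c y) (barrier2 c y) x > 0"
proof (cases "B = {}")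
  case True
  then show ?thesis by (auto intro: exI[of _ 1])
next
  case False
  let ?Q = "\<lambda>x. \<Sum>i\<in>UNIV. \<Sum>j\<in>UNIV. a i j x * (x - y) $ i * (x - y) $ j"
  let ?R = "\<lambda>x. (\<Sum>i\<in>UNIV. a i i x) + (\<Sum>i\<in>UNIV. b i x * (x - y) $ i)"
  have ca: "continuous_on B (a i j)" and cb: "continuous_on B (b i)" for i j
    using a_continuous b_continuous assms(2) continuous_on_subset by blast+
  have "continuous_on B ?Q" by (intro continuous_intros ca)
  then obtain x0 where x0: "x0 \<in> B" "\<And>x. x \<in> B \<Longrightarrow> ?Q x0 \<le> ?Q x"
    using continuous_attains_inf[OF assms(1) False] by blast
  have "continuous_on B ?R" by (intro continuous_intros ca cb)
  then obtain x1 where x1: "x1 \<in> B" "\<And>x. x \<in> B \<Longrightarrow> ?R x \<le> ?R x1"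
    using continuous_attains_sup[OF assms(1) False] by blast
  have "x0 - y \<noteq> 0" using x0 assms(3) by auto
  then have Q0: "?Q x0 > 0" using x0 assms(2) by (intro a_posdef) auto
  \<comment> \<open>This makes \<open>2 * c * ?Q x\<close> at least twice
    \<open>\<bar>?R x1\<bar> + 1\<close> on \<open>B\<close>, hence larger than \<open>?R x\<close>;
    adding 1 also ensures \<open>c > 0\<close>.\<close>
  define c where "c = (\<bar>?R x1\<bar> + 1) / ?Q x0"
  have "c > 0" using Q0 by (simp add: c_def)
  have "elliptic_op a b (barrier1 c y) (barrier2 c y) x > 0" if "x \<in> B" for x
  proof -
    have "?R x \<le> \<bar>?R x1\<bar>" using x1(2)[OF that] abs_ge_self order_trans by blast
    then have "?R x < 2 * (\<bar>?R x1\<bar> + 1)" using abs_ge_zero[of "?R x1"] by argo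
    also have "\<dots> = 2 * c * ?Q x0" using Q0 by (simp add: c_def)
    also have "\<dots> \<le> 2 * c * ?Q x" using x0(2)[OF that] \<open>c > 0\<close> by (intro mult_left_mono) auto
    finally show ?thesis
      unfolding elliptic_op_barrier using \<open>c > 0\<close> by (intro mult_pos_pos) (auto simp: barrier_def)
  qed
  then show ?thesis using \<open>c > 0\<close> by blast
qed

text \<open>At a point \<open>z\<close> of the set \<open>{f = M}\<close> nearest to \<open>y\<close>, adding a small multiple of
  the barrier centred at \<open>y'\<close> produces an interior maximum near \<open>z\<close>.\<close>

theorem strong_maximum_principle:
  assumes "x0 \<in> U"
    and f1: "\<And>x. x \<in> U \<Longrightarrow> (f has_derivative (\<lambda>v. \<Sum>i\<in>UNIV. f1 i x * v $ i)) (at x)"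
    and f2: "\<And>i x. x \<in> U \<Longrightarrow> (f1 i has_derivative (\<lambda>v. \<Sum>j\<in>UNIV. f2 i j x * v $ j)) (at x)"
    and sub: "\<And>x. x \<in> U \<Longrightarrow> elliptic_op a b f1 f2 x \<ge> 0"
    and max: "\<And>x. x \<in> U \<Longrightarrow> f x \<le> f x0"
  shows "\<exists>r>0. \<forall>y\<in>ball x0 r. f y = f x0"
proof -
  obtain R where R: "R > 0" "cball x0 R \<subseteq> U"
    using open_U assms(1) open_contains_cball by blast
  \<comment> \<open>One third each for the point \<open>y\<close>, for the step from
    \<open>y\<close> to the nearest point \<open>z\<close>, and for the ball around \<open>z\<close>
    in which the barrier is used.\<close>
  define r where "r = R / 3"
  have r: "r > 0" "cball x0 (3 * r) \<subseteq> U" using R by (auto simp: r_def)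
  have cf: "continuous_on U f"
    using f1 has_derivative_continuous continuous_at_imp_continuous_on by blast
  let ?M = "f x0"
  have False if y: "y \<in> ball x0 r" "f y \<noteq> ?M" for y
  proof -
    define K where "K = {x \<in> cball x0 (2 * r). f x = ?M}"
    have cf2: "continuous_on (cball x0 (2 * r)) f"
      by (rule continuous_on_subset[OF cf]) (use r in \<open>auto intro!: subsetD[OF r(2)]\<close>)
    have "closed K" unfolding K_def
      using continuous_closed_preimage_constant[OF cf2 closed_cball] by simp
    moreover have "x0 \<in> K" using r by (simp add: K_def)
    ultimately obtain z where z: "z \<in> K" "\<And>x. x \<in> K \<Longrightarrow> dist y z \<le> dist y x"
      using distance_attains_inf[of K y] by blast
    have fz: "f z = ?M" using z by (simp add: K_def)
    define \<rho> where "\<rho> = dist y z"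
    have "\<rho> < r" using z(2)[OF \<open>x0 \<in> K\<close>] y by (simp add: \<rho>_def dist_commute)
    have "y \<noteq> z" using y(2) fz by blast
    then have "\<rho> > 0" by (simp add: \<rho>_def)
    \<comment> \<open>The ball around \<open>y'\<close> of radius \<open>\<rho> / 2\<close> touches
      the ball around \<open>y\<close> of radius \<open>\<rho>\<close> from inside, at
      \<open>z\<close> only. Moving the centre thus makes \<open>z\<close> the only point of the
      small closed ball with \<open>f = ?M\<close>.\<close>
    define y' where "y' = midpoint y z"
    have y'z: "dist y' z = \<rho> / 2" and y'y: "dist y y' = \<rho> / 2"
      unfolding y'_def \<rho>_def by (simp_all add: dist_midpoint)
    have dz: "dist x0 z < 2 * r"
      using y \<open>\<rho> < r\<close> dist_triangle[of x0 z y] by (simp add: \<rho>_def)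
    \<comment> \<open>Smaller than the distance \<open>\<rho> / 2\<close> from \<open>y'\<close> to
      \<open>z\<close>, so the barrier's centre stays outside \<open>cball z s\<close>.\<close>
    define s where "s = \<rho> / 4"
    have s: "s > 0" "s < r" using \<open>\<rho> > 0\<close> \<open>\<rho> < r\<close> by (auto simp: s_def)
    let ?B = "cball z s"
    have BU: "?B \<subseteq> U"
    proof
      fix x assume "x \<in> ?B"
      then have "dist x0 x \<le> 3 * r"
        using dz s dist_triangle[of x0 x z] by (simp add: dist_commute)
      then show "x \<in> U" using r(2) by auto
    qed
    have "y' \<notin> ?B" using y'z \<open>\<rho> > 0\<close> by (simp add: s_def dist_commute)
    then obtain c where c: "c > 0" "\<And>x. x \<in> ?B \<Longrightarrow> elliptic_op a b (barrier1 c y') (barrier2 c y') x > 0"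
      using barrier_exists[OF compact_cball BU] by blast
    define h where "h = barrier c y'"
    \<comment> \<open>The boundary sphere is split: on \<open>S\<close> the function
      \<open>f\<close> is strictly below its maximum, and on the rest the barrier is strictly below
      its value at \<open>z\<close>.\<close>
    define S where "S = sphere z s \<inter> cball y' (\<rho> / 2)"
    have SU: "S \<subseteq> U" using BU by (auto simp: S_def)
    have fS: "f x < ?M" if "x \<in> S" for x
    proof (rule ccontr)
      assume "\<not> f x < ?M"
      then have "f x = ?M" using max[of x] SU that by fastforce
      have "dist y x \<le> \<rho>"
        using that y'y dist_triangle[of y x y'] by (simp add: S_def)
      have "dist x0 x \<le> 2 * r"
        using y \<open>dist y x \<le> \<rho>\<close> \<open>\<rho> < r\<close> dist_triangle[of x0 x y] by simp
      then have "x \<in> K" using \<open>f x = ?M\<close> by (simp add: K_def)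
      then have "dist y x = \<rho>" using z(2) \<open>dist y x \<le> \<rho>\<close> unfolding \<rho>_def by force
      \<comment> \<open>Equality in the triangle inequality puts \<open>y\<close>, \<open>y'\<close>
        and \<open>x\<close> on one line, so \<open>x\<close> is the reflection of \<open>y\<close>
        in \<open>y'\<close>, namely \<open>z\<close>. But \<open>z\<close> is the centre of the
        sphere containing \<open>x\<close>.\<close>
      have "dist y' x = \<rho> / 2" "dist y x = dist y y' + dist y' x"
        using that y'y \<open>dist y x = \<rho>\<close> dist_triangle[of y x y'] by (auto simp: S_def)
      then have *: "norm (y - x) = norm (y - y') + norm (y' - x)" by (simp add: dist_norm)
      have "norm (y - y') *\<^sub>R (y' - x) = norm (y' - x) *\<^sub>R (y - y')"
        using * norm_triangle_eq[of "y - y'" "y' - x"] by simp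
      then have "(\<rho> / 2) *\<^sub>R (y' - x) = (\<rho> / 2) *\<^sub>R (y - y')"
        using y'y \<open>dist y' x = \<rho> / 2\<close> unfolding dist_norm by (simp only:)
      moreover have "\<rho> / 2 \<noteq> 0" using \<open>\<rho> > 0\<close> by simp
      ultimately have "y' - x = y - y'" using scaleR_cancel_left by blast
      also have "y - y' = y' - z" unfolding y'_def midpoint_def
        by (simp add: vec_eq_iff field_simps)
      finally have "x = z" by simp
      then show False using that s by (simp add: S_def)
    qed
    have cfB: "continuous_on ?B f" by (rule continuous_on_subset[OF cf BU])
    obtain \<eta> where \<eta>: "\<eta> > 0" "\<And>x. x \<in> S \<Longrightarrow> f x \<le> ?M - \<eta>"
    proof (cases "S = {}")
      case True
      show ?thesis by (rule that[of 1]) (auto simp: True)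
    next
      case False
      have "compact S" unfolding S_def by (intro compact_Int_closed) auto
      moreover have "continuous_on S f" by (rule continuous_on_subset[OF cf SU])
      ultimately obtain x1 where "x1 \<in> S" "\<And>x. x \<in> S \<Longrightarrow> f x \<le> f x1"
        using continuous_attains_sup[OF _ False] by blast
      then show ?thesis using fS[of x1] by (intro that[of "?M - f x1"]) auto
    qed
    \<comment> \<open>As the barrier is at most 1, adding \<open>\<eta> / 2\<close> of it uses only
      half of the gap \<open>\<eta>\<close> on \<open>S\<close>. So \<open>F\<close> is smaller on
      the whole sphere than at \<open>z\<close> and has its maximum over the ball in the
      interior.\<close>
    define F where "F x = f x + \<eta> / 2 * h x" for x
    have hz: "h z = exp (- c * (\<rho> / 2)\<^sup>2)"
    proof -
      have "norm (z - y') = \<rho> / 2" using y'z by (simp add: dist_norm norm_minus_commute)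
      then show ?thesis unfolding h_def barrier_def power2_norm_eq_inner[symmetric] by (simp only:)
    qed
    have Fz: "F x < F z" if "x \<in> sphere z s" for x
    proof (cases "x \<in> S")
      case True
      have "h x \<le> 1" using c by (simp add: h_def barrier_def)
      then have 1: "\<eta> / 2 * h x \<le> \<eta> / 2" using \<eta>(1) by simp
      have 2: "\<eta> / 2 * h z > 0" using \<eta>(1) by (simp add: h_def barrier_def)
      show ?thesis using \<eta>(2)[OF True] \<eta>(1) 1 2 unfolding F_def fz by linarith
    next
      case False
      then have "dist x y' > \<rho> / 2" using that by (simp add: S_def dist_commute)
      then have "(\<rho> / 2)\<^sup>2 < (norm (x - y'))\<^sup>2"
        using \<open>\<rho> > 0\<close> by (intro power_strict_mono) (auto simp: dist_norm)
      then have "h x < h z"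
        unfolding hz using c(1) by (simp add: h_def barrier_def power2_norm_eq_inner)
      moreover have "f x \<le> f z" using max[of x] that BU fz by auto
      ultimately show ?thesis using \<eta>(1) by (simp add: F_def add_le_less_mono)
    qed
    have "continuous_on ?B F"
      unfolding F_def h_def barrier_def by (intro continuous_intros cfB)
    then obtain q where q: "q \<in> ?B" "\<And>x. x \<in> ?B \<Longrightarrow> F x \<le> F q"
      using continuous_attains_sup[OF compact_cball, of z s F] s by auto
    have "q \<notin> sphere z s" using Fz[of q] q(2)[of z] s by force
    then have "q \<in> ball z s" using q(1) by auto
    then obtain t where t: "t > 0" "ball q t \<subseteq> ball z s"
      using open_ball open_contains_ball by metis
    have tU: "ball q t \<subseteq> U" using t(2) BU ball_subset_cball by blast
    \<comment> \<open>At the interior maximum \<open>q\<close> the operator is nonpositive on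
      \<open>F\<close>, whereas by linearity it is a nonnegative term for \<open>f\<close> plus a
      strictly positive one for the barrier.\<close>
    have "elliptic_op a b (\<lambda>i x. f1 i x + \<eta> / 2 * barrier1 c y' i x)
        (\<lambda>i j x. f2 i j x + \<eta> / 2 * barrier2 c y' i j x) q \<le> 0"
    proof (rule local_max_elliptic_op_nonpos[of q t F])
      show "q \<in> U" using q BU by blast
      show "F x \<le> F q" if "x \<in> ball q t" for x
        by (rule q(2)) (use that t in auto)
      show "(F has_derivative (\<lambda>v. \<Sum>i\<in>UNIV. (f1 i x + \<eta> / 2 * barrier1 c y' i x) * v $ i)) (at x)"
        if "x \<in> ball q t" for x
      proof -
        have "x \<in> U" using that tU by blast
        have "(F has_derivative (\<lambda>v. (\<Sum>i\<in>UNIV. f1 i x * v $ i)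
            + \<eta> / 2 * (\<Sum>i\<in>UNIV. barrier1 c y' i x * v $ i))) (at x)"
          unfolding F_def h_def
          by (intro has_derivative_add has_derivative_mult_right f1 has_derivative_barrier \<open>x \<in> U\<close>)
        then show ?thesis by (simp add: sum_distrib_left sum.distrib distrib_right mult.assoc)
      qed
      show "((\<lambda>x. f1 i x + \<eta> / 2 * barrier1 c y' i x) has_derivative
          (\<lambda>v. \<Sum>j\<in>UNIV. (f2 i j q + \<eta> / 2 * barrier2 c y' i j q) * v $ j)) (at q)" for i
      proof -
        have "((\<lambda>x. f1 i x + \<eta> / 2 * barrier1 c y' i x) has_derivative (\<lambda>v. (\<Sum>j\<in>UNIV. f2 i j q * v $ j)
            + \<eta> / 2 * (\<Sum>j\<in>UNIV. barrier2 c y' i j q * v $ j))) (at q)"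
          using q BU
          by (intro has_derivative_add has_derivative_mult_right f2 has_derivative_barrier1) auto
        then show ?thesis by (simp add: sum_distrib_left sum.distrib distrib_right mult.assoc)
      qed
    qed fact
    moreover have "elliptic_op a b (\<lambda>i x. f1 i x + \<eta> / 2 * barrier1 c y' i x)
        (\<lambda>i j x. f2 i j x + \<eta> / 2 * barrier2 c y' i j x) q
      = elliptic_op a b f1 f2 q + \<eta> / 2 * elliptic_op a b (barrier1 c y') (barrier2 c y') q"
      by (simp add: elliptic_op_def distrib_left sum.distrib sum_distrib_left algebra_simps)
    moreover have "\<eta> / 2 * elliptic_op a b (barrier1 c y') (barrier2 c y') q > 0"
      using c(2)[OF q(1)] \<eta>(1) by simp
    moreover have "elliptic_op a b f1 f2 q \<ge> 0" using sub q(1) BU by blast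
    ultimately show False by linarith
  qed
  then show ?thesis using r(1) by blast
qed

end

subsection \<open>Charts and tangent vectors\<close>

context smooth_manifold
begin

lemma
  assumes "c \<in> A"
  shows open_cdom: "open (cdom c)"
    and open_cimg: "open (cimg c)"
    and continuous_on_coords: "continuous_on (cdom c) (coords c)"
    and continuous_on_cinv: "continuous_on (cimg c) (cinv c)"
    and coords_cinv: "x \<in> cimg c \<Longrightarrow> coords c (cinv c x) = x"
    and cinv_coords: "p \<in> cdom c \<Longrightarrow> cinv c (coords c p) = p"
    and cinv_in_cdom: "x \<in> cimg c \<Longrightarrow> cinv c x \<in> cdom c"
  using charts[OF assms] unfolding is_chart_def homeomorphism_def by auto

lemma coords_in_cimg: "p \<in> cdom c \<Longrightarrow> coords c p \<in> cimg c"
  by (simp add: cimg_def)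

lemma chart_at: "chart_at p \<in> A" "p \<in> cdom (chart_at p)"
proof -
  have "\<exists>c. c \<in> A \<and> p \<in> cdom c" using covers by blast
  from someI_ex[OF this] show "chart_at p \<in> A" "p \<in> cdom (chart_at p)"
    unfolding chart_at_def by blast+
qed

definition overlap :: "('a, 'n) chart \<Rightarrow> ('a, 'n) chart \<Rightarrow> (real^'n) set" where
  "overlap c d = coords c ` (cdom c \<inter> cdom d)"

lemma in_overlap_iff:
  assumes "c \<in> A" "d \<in> A"
  shows "x \<in> overlap c d \<longleftrightarrow> x \<in> cimg c \<and> cinv c x \<in> cdom d"
  using assms unfolding overlap_def
  by (force simp: cinv_coords coords_in_cimg coords_cinv cinv_in_cdom)

lemma open_overlap:
  assumes "c \<in> A" "d \<in> A"
  shows "open (overlap c d)"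
proof -
  have "overlap c d = cimg c \<inter> cinv c -` cdom d"
    using in_overlap_iff[OF assms] by auto
  then show ?thesis
    using continuous_open_preimage[OF continuous_on_cinv open_cimg open_cdom] assms by simp
qed

lemma coords_in_overlap: "p \<in> cdom c \<Longrightarrow> p \<in> cdom d \<Longrightarrow> coords c p \<in> overlap c d"
  by (simp add: overlap_def)

lemma smooth_on_transition:
  "c \<in> A \<Longrightarrow> d \<in> A \<Longrightarrow> smooth_on (overlap c d) (coords d \<circ> cinv c)"
  unfolding overlap_def by (rule compatible)

lemma has_derivative_transition:
  assumes "c \<in> A" "d \<in> A" "p \<in> cdom c" "p \<in> cdom d"
  shows "((coords d \<circ> cinv c) has_derivative transition_deriv c d p) (at (coords c p))"
  unfolding transition_deriv_def
  using assms by (intro smooth_on_has_derivative[OF smooth_on_transition coords_in_overlap])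

text \<open>The chain rule for \<open>f \<circ> cinv d\<close> after the transition map, valid near
  \<open>coords c p\<close> because the overlap is open. The general target type allows
  \<open>f\<close> to be another coordinate map, which yields the cocycle rule below.\<close>

lemma has_derivative_change_chart:
  fixes f :: "'a \<Rightarrow> 'b::real_normed_vector"
  assumes "c \<in> A" "d \<in> A" "p \<in> cdom c" "p \<in> cdom d"
    and "((f \<circ> cinv d) has_derivative D) (at (coords d p))"
  shows "((f \<circ> cinv c) has_derivative (\<lambda>v. D (transition_deriv c d p v))) (at (coords c p))"
proof -
  have "((\<lambda>x. (f \<circ> cinv d) ((coords d \<circ> cinv c) x)) has_derivative (\<lambda>v. D (transition_deriv c d p v)))
      (at (coords c p))"
    by (rule has_derivative_compose[OF has_derivative_transition])
       (use assms in \<open>simp_all add: cinv_coords coords_in_cimg o_def\<close>)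
  then show ?thesis
    by (rule has_derivative_transform_within_open[OF _ open_overlap[of c d]])
       (use assms in \<open>auto simp: coords_in_overlap in_overlap_iff cinv_coords coords_in_cimg\<close>)
qed

lemma transition_deriv_trans:
  assumes "c \<in> A" "d \<in> A" "e \<in> A" "p \<in> cdom c" "p \<in> cdom d" "p \<in> cdom e"
  shows "transition_deriv d e p (transition_deriv c d p w) = transition_deriv c e p w"
  using has_derivative_unique[OF has_derivative_transition[of c e p]
      has_derivative_change_chart[OF assms(1,2,4,5) has_derivative_transition[of d e p]]] assms
  by (simp add: fun_eq_iff)

lemma transition_deriv_self:
  assumes "c \<in> A" "p \<in> cdom c"
  shows "transition_deriv c c p w = w"
proof -
  have "((coords c \<circ> cinv c) has_derivative (\<lambda>w. w)) (at (coords c p))"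
    by (rule has_derivative_transform_within_open[OF has_derivative_ident open_cimg[of c]])
       (use assms in \<open>simp_all add: coords_in_cimg coords_cinv\<close>)
  from has_derivative_unique[OF this has_derivative_transition[of c c p]] show ?thesis
    using assms by (simp add: fun_eq_iff)
qed

lemma linear_transition_deriv:
  assumes "c \<in> A" "d \<in> A" "p \<in> cdom c" "p \<in> cdom d"
  shows "linear (transition_deriv c d p)"
  using has_derivative_transition[OF assms] by (rule has_derivative_linear)

section \<open>Tangent vectors and differentials seen in one chart\<close>

text \<open>Inverse of the component map \<open>v c\<close> on \<open>tangent_space p\<close>. It
  identifies the tangent space with coordinate space, so that metric and gradient can be computed in
  any single chart.\<close>

definition tvec_of :: "('a, 'n) chart \<Rightarrow> 'a \<Rightarrow> real^'n \<Rightarrow> ('a, 'n) tvec" where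
  "tvec_of c p w = (\<lambda>d. if d \<in> A \<and> p \<in> cdom d then transition_deriv c d p w else 0)"

lemma coord_vec_eq: "coord_vec c i p = tvec_of c p (axis i 1)"
  by (simp add: coord_vec_def tvec_of_def)

lemma tvec_of_in_tangent_space:
  "c \<in> A \<Longrightarrow> p \<in> cdom c \<Longrightarrow> tvec_of c p w \<in> tangent_space p"
  unfolding tangent_space_def tvec_of_def by (auto simp: transition_deriv_trans)

lemma tvec_of_component: "c \<in> A \<Longrightarrow> p \<in> cdom c \<Longrightarrow> tvec_of c p w c = w"
  by (simp add: tvec_of_def transition_deriv_self)

lemma tangent_space_change_chart:
  assumes "c \<in> A" "d \<in> A" "p \<in> cdom c" "p \<in> cdom d" "v \<in> tangent_space p"
  shows "v d = transition_deriv c d p (v c)"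
  using assms unfolding tangent_space_def by blast

lemma tangent_space_eq_tvec_of:
  assumes "c \<in> A" "p \<in> cdom c" "v \<in> tangent_space p"
  shows "v = tvec_of c p (v c)"
proof
  fix d
  show "v d = tvec_of c p (v c) d"
  proof (cases "d \<in> A \<and> p \<in> cdom d")
    case True
    then show ?thesis
      using tangent_space_change_chart[OF assms(1) _ assms(2) _ assms(3), of d] by (simp add: tvec_of_def)
  next
    case False
    then have "v d = 0" using assms(3) unfolding tangent_space_def by blast
    then show ?thesis using False by (auto simp: tvec_of_def)
  qed
qed

lemma tvec_of_change_chart:
  assumes "c \<in> A" "d \<in> A" "p \<in> cdom c" "p \<in> cdom d"
  shows "tvec_of c p w = tvec_of d p (transition_deriv c d p w)"
  using tangent_space_eq_tvec_of[OF assms(2,4) tvec_of_in_tangent_space[OF assms(1,3)]] assms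
  by (simp add: tvec_of_def)

lemma tvec_of_linear:
  assumes "c \<in> A" "p \<in> cdom c"
  shows "tvec_of c p (a *\<^sub>R w + b *\<^sub>R z) = (\<lambda>d. a *\<^sub>R tvec_of c p w d + b *\<^sub>R tvec_of c p z d)"
  using linear_transition_deriv[OF assms(1) _ assms(2)]
  by (auto simp: tvec_of_def fun_eq_iff linear_add linear_cmul)

definition dcoord :: "('a, 'n) chart \<Rightarrow> ('a \<Rightarrow> real) \<Rightarrow> real^'n \<Rightarrow> real^'n" where
  "dcoord c f x = (\<chi> i. frechet_derivative (f \<circ> cinv c) (at x) (axis i 1))"

text \<open>The derivative along \<open>i\<close> is taken first, the one along \<open>j\<close>
  second.\<close>

definition d2coord :: "('a, 'n) chart \<Rightarrow> ('a \<Rightarrow> real) \<Rightarrow> 'n \<Rightarrow> 'n \<Rightarrow> real^'n \<Rightarrow> real" where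
  "d2coord c f i j x = frechet_derivative (\<lambda>y. dcoord c f y $ i) (at x) (axis j 1)"

context
  fixes f :: "'a \<Rightarrow> real" and c :: "('a, 'n) chart"
  assumes f: "smooth f" and c: "c \<in> A"
begin

lemma smooth_on_chart: "smooth_on (cimg c) (f \<circ> cinv c)"
  using f c by (simp add: smooth_def)

lemma has_derivative_chart:
  assumes "x \<in> cimg c"
  shows "((f \<circ> cinv c) has_derivative (\<lambda>v. \<Sum>i\<in>UNIV. dcoord c f x $ i * v $ i)) (at x)"
proof -
  have d: "((f \<circ> cinv c) has_derivative frechet_derivative (f \<circ> cinv c) (at x)) (at x)"
    by (rule smooth_on_has_derivative[OF smooth_on_chart assms])
  have "frechet_derivative (f \<circ> cinv c) (at x) = (\<lambda>v. \<Sum>i\<in>UNIV. dcoord c f x $ i * v $ i)"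
    unfolding dcoord_def vec_lambda_beta by (rule ext) (rule linear_eq_sum_axis[OF has_derivative_linear[OF d]])
  then show ?thesis using d by simp
qed

lemma has_derivative_dcoord_nth:
  assumes "x \<in> cimg c"
  shows "((\<lambda>y. dcoord c f y $ i) has_derivative (\<lambda>v. \<Sum>j\<in>UNIV. d2coord c f i j x * v $ j)) (at x)"
proof -
  have "smooth_on (cimg c) (\<lambda>y. dcoord c f y $ i)"
    using smooth_on_frechet_derivative[OF smooth_on_chart, of "axis i 1"] by (simp add: dcoord_def)
  from smooth_on_has_derivative[OF this assms]
  have d: "((\<lambda>y. dcoord c f y $ i) has_derivative frechet_derivative (\<lambda>y. dcoord c f y $ i) (at x)) (at x)" .
  have "frechet_derivative (\<lambda>y. dcoord c f y $ i) (at x) = (\<lambda>v. \<Sum>j\<in>UNIV. d2coord c f i j x * v $ j)"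
    unfolding d2coord_def by (rule ext) (rule linear_eq_sum_axis[OF has_derivative_linear[OF d]])
  then show ?thesis using d by simp
qed

lemma has_derivative_dcoord:
  assumes "x \<in> cimg c"
  shows "(dcoord c f has_derivative (\<lambda>v. \<chi> i. \<Sum>j\<in>UNIV. d2coord c f i j x * v $ j)) (at x)"
  by (rule has_derivative_vecI) (simp add: has_derivative_dcoord_nth[OF assms])

end

lemma smooth_continuous_on:
  assumes "smooth f"
  shows "continuous_on UNIV f"
proof -
  have "continuous_on (\<Union>c\<in>A. cdom c) f"
  proof (rule continuous_on_open_UN)
    fix c assume c: "c \<in> A"
    have "continuous_on (cimg c) (f \<circ> cinv c)"
      using assms c unfolding smooth_def by (intro smooth_on_continuous_on) auto
    then have "continuous_on (cdom c) ((f \<circ> cinv c) \<circ> coords c)"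
      unfolding cimg_def by (intro continuous_on_compose[OF continuous_on_coords[OF c]])
    then show "continuous_on (cdom c) f"
      by (rule continuous_on_eq) (simp add: cinv_coords[OF c])
  qed (rule open_cdom)
  then show ?thesis by (simp add: covers)
qed

lemma smooth_bounded_linear:
  assumes "smooth f" "bounded_linear L"
  shows "smooth (\<lambda>q. L (f q))"
  unfolding smooth_def
proof
  fix c assume c: "c \<in> A"
  have "smooth_on (cimg c) (\<lambda>x. L ((f \<circ> cinv c) x))"
    using smooth_on_linear_compose[OF open_cimg[OF c] _ assms(2), of "f \<circ> cinv c"] assms(1) c
    by (simp add: smooth_def)
  then show "smooth_on (cimg c) ((\<lambda>q. L (f q)) \<circ> cinv c)" by (simp add: o_def)
qed

lemma smooth_add:
  assumes "smooth f" "smooth h"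
  shows "smooth (\<lambda>q. f q + h q)"
  unfolding smooth_def
proof
  fix c assume c: "c \<in> A"
  have "smooth_on (cimg c) (\<lambda>x. (f \<circ> cinv c) x + (h \<circ> cinv c) x)"
    using assms c by (intro smooth_on_add open_cimg) (simp_all add: smooth_def o_def)
  then show "smooth_on (cimg c) ((\<lambda>q. f q + h q) \<circ> cinv c)" by (simp add: o_def)
qed

lemma smooth_lincomb:
  fixes f h :: "'a \<Rightarrow> real"
  assumes "smooth f" "smooth h"
  shows "smooth (\<lambda>q. a * f q + b * h q)"
  by (intro smooth_add smooth_bounded_linear[OF _ bounded_linear_mult_right] assms)

lemma dcoord_lincomb:
  assumes "smooth f" "smooth h" "c \<in> A" "x \<in> cimg c"
  shows "dcoord c (\<lambda>q. a * f q + b * h q) x $ i = a * dcoord c f x $ i + b * dcoord c h x $ i"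
proof -
  have "((\<lambda>y. a * (f \<circ> cinv c) y + b * (h \<circ> cinv c) y) has_derivative
     (\<lambda>v. a * frechet_derivative (f \<circ> cinv c) (at x) v + b * frechet_derivative (h \<circ> cinv c) (at x) v)) (at x)"
    using assms by (intro has_derivative_add has_derivative_mult_right
        smooth_on_has_derivative[OF smooth_on_chart])
  then show ?thesis
    unfolding dcoord_def by (simp add: o_def frechet_derivative_eqI)
qed

lemma d2coord_lincomb:
  assumes "smooth f" "smooth h" "c \<in> A" "x \<in> cimg c"
  shows "d2coord c (\<lambda>q. a * f q + b * h q) i j x = a * d2coord c f i j x + b * d2coord c h i j x"
proof -
  have "((\<lambda>y. a * dcoord c f y $ i + b * dcoord c h y $ i) has_derivative
      (\<lambda>v. a * (\<Sum>j\<in>UNIV. d2coord c f i j x * v $ j) + b * (\<Sum>j\<in>UNIV. d2coord c h i j x * v $ j))) (at x)"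
    using assms by (intro has_derivative_add has_derivative_mult_right has_derivative_dcoord_nth)
  then have "((\<lambda>y. dcoord c (\<lambda>q. a * f q + b * h q) y $ i) has_derivative
      (\<lambda>v. a * (\<Sum>j\<in>UNIV. d2coord c f i j x * v $ j) + b * (\<Sum>j\<in>UNIV. d2coord c h i j x * v $ j))) (at x)"
    by (rule has_derivative_transform_within_open[OF _ open_cimg[OF assms(3)] assms(4)])
       (simp add: dcoord_lincomb assms)
  from frechet_derivative_eqI[OF this] show ?thesis
    unfolding d2coord_def[of _ "\<lambda>q. a * f q + b * h q"]
    by (simp add: axis_def if_distrib cong: if_cong)
qed

text \<open>The definition uses \<open>chart_at p\<close>; the chain rule and the transformation law
  of tangent vectors cancel against each other and allow any chart around \<open>p\<close>.\<close>

lemma differential_chart: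
  assumes "smooth f" "c \<in> A" "p \<in> cdom c" "v \<in> tangent_space p"
  shows "differential f p v = dcoord c f (coords c p) \<bullet> v c"
proof -
  let ?d = "chart_at p"
  have "((f \<circ> cinv ?d) has_derivative frechet_derivative (f \<circ> cinv ?d) (at (coords ?d p))) (at (coords ?d p))"
    by (rule smooth_on_has_derivative[OF smooth_on_chart[OF assms(1) chart_at(1)]])
       (simp add: coords_in_cimg chart_at)
  from has_derivative_change_chart[OF assms(2) chart_at(1) assms(3) chart_at(2) this]
  have "(\<lambda>v. frechet_derivative (f \<circ> cinv ?d) (at (coords ?d p)) (transition_deriv c ?d p v))
      = (\<lambda>v. \<Sum>i\<in>UNIV. dcoord c f (coords c p) $ i * v $ i)"
    by (rule has_derivative_unique) (intro has_derivative_chart assms coords_in_cimg)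
  then show ?thesis
    using tangent_space_change_chart[OF assms(2) chart_at(1) assms(3) chart_at(2) assms(4)]
    by (simp add: differential_def Let_def inner_vec_def fun_eq_iff)
qed

end

subsection \<open>Gradient and Laplacian in a chart\<close>

context riemannian_manifold
begin

section \<open>The metric matrix and its inverse\<close>

definition metric_matrix :: "('a, 'n) chart \<Rightarrow> real^'n \<Rightarrow> real^'n^'n" where
  "metric_matrix c x = (\<chi> k l. metric_coeff c k l (cinv c x))"

lemma metric_lincomb_left:
  assumes "c \<in> A" "p \<in> cdom c" "v \<in> tangent_space p"
  shows "g p (tvec_of c p (a *\<^sub>R w + b *\<^sub>R z)) v = a * g p (tvec_of c p w) v + b * g p (tvec_of c p z) v"
  unfolding tvec_of_linear[OF assms(1,2)]
  by (intro g_linear tvec_of_in_tangent_space assms)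

lemma linear_metric_left:
  assumes "c \<in> A" "p \<in> cdom c" "v \<in> tangent_space p"
  shows "linear (\<lambda>w. g p (tvec_of c p w) v)"
  using metric_lincomb_left[OF assms, where a=1 and b=1] metric_lincomb_left[OF assms, where b=0]
  by (intro linearI) simp_all

lemma metric_tvec_of:
  assumes "c \<in> A" "p \<in> cdom c"
  shows "g p (tvec_of c p w) (tvec_of c p z) = w \<bullet> (metric_matrix c (coords c p) *v z)"
proof -
  note T = tvec_of_in_tangent_space[OF assms]
  have 1: "g p (tvec_of c p (axis i 1)) (tvec_of c p z)
      = (\<Sum>j\<in>UNIV. metric_coeff c i j p * z $ j)" for i
  proof -
    have "g p (tvec_of c p (axis i 1)) (tvec_of c p z) = g p (tvec_of c p z) (tvec_of c p (axis i 1))"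
      by (rule g_sym[OF T T])
    also have "\<dots> = (\<Sum>j\<in>UNIV. g p (tvec_of c p (axis j 1)) (tvec_of c p (axis i 1)) * z $ j)"
      by (rule linear_eq_sum_axis[OF linear_metric_left[OF assms T]])
    also have "\<dots> = (\<Sum>j\<in>UNIV. metric_coeff c i j p * z $ j)"
      by (intro sum.cong refl) (simp add: metric_coeff_def coord_vec_eq g_sym[OF T T])
    finally show ?thesis .
  qed
  have "g p (tvec_of c p w) (tvec_of c p z) = (\<Sum>i\<in>UNIV. g p (tvec_of c p (axis i 1)) (tvec_of c p z) * w $ i)"
    by (rule linear_eq_sum_axis[OF linear_metric_left[OF assms T]])
  then show ?thesis
    unfolding 1 using assms by (simp add: inner_vec_def matrix_vector_mult_def metric_matrix_def cinv_coords mult.commute)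
qed

lemma metric_matrix_sym:
  assumes "c \<in> A" "x \<in> cimg c"
  shows "metric_matrix c x $ i $ j = metric_matrix c x $ j $ i"
  using g_sym[OF tvec_of_in_tangent_space tvec_of_in_tangent_space] assms cinv_in_cdom
  by (simp add: metric_matrix_def metric_coeff_def coord_vec_eq)

lemma metric_matrix_posdef:
  assumes "c \<in> A" "x \<in> cimg c" "w \<noteq> 0"
  shows "w \<bullet> (metric_matrix c x *v w) > 0"
proof -
  let ?p = "cinv c x"
  have p: "?p \<in> cdom c" using assms cinv_in_cdom by blast
  have "tvec_of c ?p w \<noteq> (\<lambda>_. 0)"
    using tvec_of_component[OF assms(1) p, of w] assms(3) by auto
  from g_pos[OF tvec_of_in_tangent_space[OF assms(1) p] this] show ?thesis
    using assms by (simp add: metric_tvec_of p coords_cinv)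
qed

lemma invertible_metric_matrix:
  assumes "c \<in> A" "x \<in> cimg c"
  shows "invertible (metric_matrix c x)"
proof -
  have "w = 0" if "metric_matrix c x *v w = 0" for w
    using metric_matrix_posdef[OF assms, of w] that by force
  then show ?thesis
    unfolding invertible_left_inverse matrix_left_invertible_ker by blast
qed

definition inv_metric :: "('a, 'n) chart \<Rightarrow> real^'n \<Rightarrow> real^'n^'n" where
  "inv_metric c x = matrix_inv (metric_matrix c x)"

lemma transpose_metric_matrix:
  "c \<in> A \<Longrightarrow> x \<in> cimg c \<Longrightarrow> transpose (metric_matrix c x) = metric_matrix c x"
  by (simp add: transpose_def vec_eq_iff metric_matrix_sym[of c x])

lemma transpose_inv_metric:
  assumes "c \<in> A" "x \<in> cimg c"
  shows "transpose (inv_metric c x) = inv_metric c x"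
proof -
  note G = matrix_inv_inverse[OF invertible_metric_matrix[OF assms], folded inv_metric_def]
  have "transpose (inv_metric c x ** metric_matrix c x) = mat 1" by (simp add: G)
  then have "metric_matrix c x ** transpose (inv_metric c x) = mat 1"
    by (simp add: matrix_transpose_mul transpose_metric_matrix assms)
  from matrix_inv_unique[OF this] show ?thesis by (simp add: inv_metric_def)
qed

lemma inv_metric_sym:
  assumes "c \<in> A" "x \<in> cimg c"
  shows "inv_metric c x $ i $ j = inv_metric c x $ j $ i"
proof -
  have "inv_metric c x $ i $ j = transpose (inv_metric c x) $ i $ j"
    by (simp only: transpose_inv_metric[OF assms])
  then show ?thesis by (simp add: transpose_def)
qed

lemma metric_matrix_inv_metric:
  assumes "c \<in> A" "x \<in> cimg c"
  shows "metric_matrix c x *v (inv_metric c x *v w) = w"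
  using matrix_inv_inverse[OF invertible_metric_matrix[OF assms], folded inv_metric_def]
  by (simp add: matrix_vector_mul_assoc)

text \<open>Substituting w = G u turns the form of the inverse matrix at w into that of G at u. This
  will be the ellipticity of the Laplacian.\<close>

lemma inv_metric_posdef:
  assumes "c \<in> A" "x \<in> cimg c" "w \<noteq> 0"
  shows "w \<bullet> (inv_metric c x *v w) > 0"
proof -
  let ?u = "inv_metric c x *v w"
  have w: "w = metric_matrix c x *v ?u" by (simp add: metric_matrix_inv_metric assms)
  have "?u \<noteq> 0"
  proof
    assume "?u = 0"
    with w have "w = metric_matrix c x *v 0" by simp
    with assms(3) show False by simp
  qed
  from metric_matrix_posdef[OF assms(1,2) this] show ?thesis
    by (simp add: metric_matrix_inv_metric assms inner_commute)
qed

lemma smooth_on_metric_matrix_nth: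
  assumes "c \<in> A"
  shows "smooth_on (cimg c) (\<lambda>x. metric_matrix c x $ i $ j)"
  using g_smooth[OF assms, of i j] by (simp add: metric_matrix_def metric_coeff_def)

lemma has_derivative_metric_matrix:
  assumes "c \<in> A" "x \<in> cimg c"
  shows "(metric_matrix c has_derivative
    (\<lambda>v. \<chi> i j. frechet_derivative (\<lambda>y. metric_matrix c y $ i $ j) (at x) v)) (at x)"
  by (intro has_derivative_vecI)
     (simp add: smooth_on_has_derivative[OF smooth_on_metric_matrix_nth[OF assms(1)] assms(2)])

lemma differentiable_metric_matrix:
  assumes "c \<in> A" "x \<in> cimg c"
  shows "metric_matrix c differentiable (at x)"
  using has_derivative_metric_matrix[OF assms] by (auto simp: differentiable_def)

lemma frechet_derivative_metric_matrix:
  assumes "c \<in> A" "x \<in> cimg c"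
  shows "frechet_derivative (metric_matrix c) (at x) v $ i $ j
    = frechet_derivative (\<lambda>y. metric_matrix c y $ i $ j) (at x) v"
  by (simp add: frechet_derivative_eqI[OF has_derivative_metric_matrix[OF assms]])

lemma continuous_on_frechet_derivative_metric_matrix:
  assumes "c \<in> A"
  shows "continuous_on (cimg c) (\<lambda>x. frechet_derivative (metric_matrix c) (at x) v)"
proof -
  have "continuous_on (cimg c) (\<lambda>x. frechet_derivative (\<lambda>y. metric_matrix c y $ i $ j) (at x) v)" for i j
    by (intro smooth_on_continuous_on smooth_on_frechet_derivative smooth_on_metric_matrix_nth assms)
  then have "continuous_on (cimg c) (\<lambda>x. \<chi> i j. frechet_derivative (\<lambda>y. metric_matrix c y $ i $ j) (at x) v)"
    by (intro continuous_on_vec_lambda)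
  then show ?thesis
    by (rule continuous_on_eq) (simp add: vec_eq_iff frechet_derivative_metric_matrix assms)
qed

lemma continuous_on_inv_metric:
  assumes "c \<in> A"
  shows "continuous_on (cimg c) (inv_metric c)"
proof -
  have "isCont (inv_metric c) x" if "x \<in> cimg c" for x
    using differentiable_matrix_inv[OF open_cimg that invertible_metric_matrix
        differentiable_metric_matrix] assms that
    unfolding inv_metric_def[abs_def] by (intro differentiable_imp_continuous_within) auto
  then show ?thesis by (simp add: continuous_at_imp_continuous_on)
qed

section \<open>The gradient and its divergence in a chart\<close>

definition grad_coord :: "('a, 'n) chart \<Rightarrow> ('a \<Rightarrow> real) \<Rightarrow> real^'n \<Rightarrow> real^'n" where
  "grad_coord c f x = inv_metric c x *v dcoord c f x"

text \<open>Existence and uniqueness behind the definite description: in a chart its condition says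
  G w = df when tested against all vectors, and G is invertible.\<close>

lemma gradient_eq:
  assumes "smooth f" "c \<in> A" "p \<in> cdom c"
  shows "gradient f p = tvec_of c p (grad_coord c f (coords c p))"
  unfolding gradient_def
proof (rule the_equality)
  let ?X = "tvec_of c p (grad_coord c f (coords c p))"
  note T = tvec_of_in_tangent_space[OF assms(2,3)]
  have char: "g p (tvec_of c p w) v = differential f p v \<longleftrightarrow>
      (metric_matrix c (coords c p) *v w) \<bullet> v c = dcoord c f (coords c p) \<bullet> v c"
    if "v \<in> tangent_space p" for v w
  proof -
    have "g p (tvec_of c p w) v = g p (tvec_of c p (v c)) (tvec_of c p w)"
      using g_sym[OF T that] tangent_space_eq_tvec_of[OF assms(2,3) that] by simp
    then show ?thesis
      by (simp add: metric_tvec_of differential_chart[of f c] assms that inner_commute)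
  qed
  show "?X \<in> tangent_space p \<and> (\<forall>v\<in>tangent_space p. g p ?X v = differential f p v)"
    using T char by (simp add: grad_coord_def metric_matrix_inv_metric assms coords_in_cimg)
  fix Y assume Y: "Y \<in> tangent_space p \<and> (\<forall>v\<in>tangent_space p. g p Y v = differential f p v)"
  define w where "w = Y c"
  have Yw: "Y = tvec_of c p w"
    using tangent_space_eq_tvec_of[OF assms(2,3)] Y unfolding w_def by blast
  have "(metric_matrix c (coords c p) *v w) \<bullet> u = dcoord c f (coords c p) \<bullet> u" for u
    using char[OF T, of w u] Y T unfolding Yw by (simp add: tvec_of_component assms)
  then have "metric_matrix c (coords c p) *v w = dcoord c f (coords c p)"
    using vector_eq_rdot by blast
  then have "inv_metric c (coords c p) *v (metric_matrix c (coords c p) *v w) = grad_coord c f (coords c p)"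
    by (simp add: grad_coord_def)
  then have "w = grad_coord c f (coords c p)"
    using matrix_inv_inverse[OF invertible_metric_matrix[OF assms(2) coords_in_cimg[OF assms(3)]]]
    by (simp add: inv_metric_def matrix_vector_mul_assoc)
  then show "Y = ?X" by (simp add: Yw)
qed

lemma gradient_component:
  assumes "smooth f" "c \<in> A" "p \<in> cdom c"
  shows "gradient f p c = grad_coord c f (coords c p)"
  by (simp add: gradient_eq[of f c] assms tvec_of_component)

lemma gradient_in_tangent_space: "smooth f \<Longrightarrow> gradient f p \<in> tangent_space p"
  using gradient_eq[OF _ chart_at] tvec_of_in_tangent_space[OF chart_at] by metis

lemma metric_gradient:
  assumes "smooth f" "smooth h" "c \<in> A" "p \<in> cdom c"
  shows "g p (gradient f p) (gradient h p) =
    (\<Sum>i\<in>UNIV. \<Sum>j\<in>UNIV. inv_metric c (coords c p) $ i $ j * dcoord c f (coords c p) $ i * dcoord c h (coords c p) $ j)"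
proof -
  have x: "coords c p \<in> cimg c" by (rule coords_in_cimg[OF assms(4)])
  have "g p (gradient f p) (gradient h p) = dcoord c h (coords c p) \<bullet> (inv_metric c (coords c p) *v dcoord c f (coords c p))"
    by (simp add: gradient_eq[of _ c] assms metric_tvec_of)
       (simp add: grad_coord_def metric_matrix_inv_metric assms x inner_commute)
  also have "\<dots> = (\<Sum>i\<in>UNIV. \<Sum>j\<in>UNIV. inv_metric c (coords c p) $ i $ j * dcoord c f (coords c p) $ j * dcoord c h (coords c p) $ i)"
    by (simp add: inner_vec_def matrix_vector_mult_def sum_distrib_left algebra_simps)
  also have "\<dots> = (\<Sum>i\<in>UNIV. \<Sum>j\<in>UNIV. inv_metric c (coords c p) $ i $ j * dcoord c f (coords c p) $ i * dcoord c h (coords c p) $ j)"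
    by (subst sum.swap) (simp add: inv_metric_sym[OF assms(3) x])
  finally show ?thesis .
qed

lemma has_derivative_grad_coord:
  assumes "smooth f" "c \<in> A" "x \<in> cimg c"
  shows "\<exists>D. (grad_coord c f has_derivative D) (at x)"
  using coord_div_gradient(1)[OF open_cimg[OF assms(2)] assms(3) invertible_metric_matrix
      differentiable_metric_matrix has_derivative_dcoord[OF assms(1-3)]] assms
  unfolding grad_coord_def[abs_def] inv_metric_def by blast

lemma coord_div_grad_coord:
  assumes "smooth f" "c \<in> A" "x \<in> cimg c"
  shows "coord_div (metric_matrix c) (grad_coord c f) x =
    (\<Sum>i\<in>UNIV. \<Sum>j\<in>UNIV. inv_metric c x $ i $ j * d2coord c f i j x)
     + (\<Sum>j\<in>UNIV. lap_drift (metric_matrix c) j x * dcoord c f x $ j)"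
proof -
  have "coord_div (metric_matrix c) (grad_coord c f) x =
    (\<Sum>i\<in>UNIV. \<Sum>j\<in>UNIV. inv_metric c x $ i $ j * d2coord c f j i x)
     + (\<Sum>j\<in>UNIV. lap_drift (metric_matrix c) j x * dcoord c f x $ j)"
    using coord_div_gradient(2)[OF open_cimg[OF assms(2)] assms(3) invertible_metric_matrix
      differentiable_metric_matrix has_derivative_dcoord[OF assms(1-3)]] assms
    unfolding grad_coord_def[abs_def] inv_metric_def
    by (simp add: axis_def if_distrib cong: if_cong)
  \<comment> \<open>Symmetry of the inverse metric absorbs the exchange of the two differentiation
    indices.\<close>
  also have "(\<Sum>i\<in>UNIV. \<Sum>j\<in>UNIV. inv_metric c x $ i $ j * d2coord c f j i x)
      = (\<Sum>i\<in>UNIV. \<Sum>j\<in>UNIV. inv_metric c x $ i $ j * d2coord c f i j x)"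
    by (subst sum.swap) (simp add: inv_metric_sym[OF assms(2,3)])
  finally show ?thesis .
qed

text \<open>In the trace of the Christoffel symbols only one of the three derivatives of the metric
  survives.\<close>

lemma christoffel_trace:
  assumes "c \<in> A" "p \<in> cdom c"
  shows "(\<Sum>i\<in>UNIV. \<Sum>j\<in>UNIV. christoffel c i i j p * w $ j) =
    trace (inv_metric c (coords c p) ** frechet_derivative (metric_matrix c) (at (coords c p)) w) / 2"
proof -
  let ?x = "coords c p"
  let ?H = "inv_metric c ?x"
  define D where "D j i l = frechet_derivative (metric_matrix c) (at ?x) (axis j 1) $ i $ l" for j i l
  have x: "?x \<in> cimg c" by (rule coords_in_cimg[OF assms(2)])
  have inv: "inv_metric_coeff c i j p = ?H $ i $ j" for i j
    using assms by (simp add: inv_metric_coeff_def inv_metric_def metric_matrix_def cinv_coords)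
  have pd: "partial_deriv c i (metric_coeff c j l) p = D i j l" for i j l
    by (simp add: partial_deriv_def D_def frechet_derivative_metric_matrix[OF assms(1) x])
       (simp add: metric_matrix_def o_def)
  have Dsym: "D j i l = D j l i" for j i l
  proof -
    have "frechet_derivative (\<lambda>y. metric_matrix c y $ i $ l) (at ?x)
        = frechet_derivative (\<lambda>y. metric_matrix c y $ l $ i) (at ?x)"
      by (rule frechet_derivative_transform_within_open[OF _ open_cimg[OF assms(1)] x])
         (use smooth_on_differentiable[OF smooth_on_metric_matrix_nth[OF assms(1)] x]
            metric_matrix_sym[OF assms(1)] in auto)
    then show ?thesis by (simp add: D_def frechet_derivative_metric_matrix[OF assms(1) x])
  qed
  \<comment> \<open>Contraction with the symmetric inverse metric cancels the first against the
    third derivative in the Christoffel symbol; the derivative along \<open>j\<close>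
    remains.\<close>
  have tr: "(\<Sum>i\<in>UNIV. christoffel c i i j p) = (\<Sum>i\<in>UNIV. \<Sum>l\<in>UNIV. ?H $ i $ l * D j i l) / 2" for j
  proof -
    have "(\<Sum>i\<in>UNIV. \<Sum>l\<in>UNIV. ?H $ i $ l * D i j l) = (\<Sum>i\<in>UNIV. \<Sum>l\<in>UNIV. ?H $ i $ l * D l j i)"
      by (subst sum.swap) (simp add: inv_metric_sym[OF assms(1) x])
    then have "(\<Sum>i\<in>UNIV. \<Sum>l\<in>UNIV. ?H $ i $ l * D i j l) = (\<Sum>i\<in>UNIV. \<Sum>l\<in>UNIV. ?H $ i $ l * D l i j)"
      by (simp add: Dsym[of _ j])
    then show ?thesis
      by (simp add: christoffel_def inv pd distrib_left right_diff_distrib sum.distrib sum_subtractf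
          flip: sum_divide_distrib)
  qed
  have lin: "linear (\<lambda>w. trace (?H ** frechet_derivative (metric_matrix c) (at ?x) w))"
    using bounded_linear_compose[OF bounded_linear_trace
        bounded_linear_compose[OF bounded_bilinear.bounded_linear_right[OF bounded_bilinear_matrix_matrix_mult]
          has_derivative_bounded_linear[OF differentiable_metric_matrix[OF assms(1) x, unfolded frechet_derivative_works]]]]
    by (rule bounded_linear.linear)
  have 1: "trace (?H ** frechet_derivative (metric_matrix c) (at ?x) (axis j 1))
      = (\<Sum>i\<in>UNIV. \<Sum>l\<in>UNIV. ?H $ i $ l * D j i l)" for j
    unfolding trace_def matrix_matrix_mult_def vec_lambda_beta D_def[symmetric]
    by (intro sum.cong refl) (simp only: Dsym[of j])
  have "trace (?H ** frechet_derivative (metric_matrix c) (at ?x) w) =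
      (\<Sum>j\<in>UNIV. trace (?H ** frechet_derivative (metric_matrix c) (at ?x) (axis j 1)) * w $ j)"
    by (rule linear_eq_sum_axis[OF lin])
  then have "trace (?H ** frechet_derivative (metric_matrix c) (at ?x) w) / 2
      = (\<Sum>j\<in>UNIV. (\<Sum>i\<in>UNIV. christoffel c i i j p) * w $ j)"
    unfolding 1 tr by (simp flip: sum_divide_distrib)
  also have "\<dots> = (\<Sum>i\<in>UNIV. \<Sum>j\<in>UNIV. christoffel c i i j p * w $ j)"
    unfolding sum_distrib_right by (rule sum.swap)
  finally show ?thesis by simp
qed

text \<open>In the definition of the divergence at \<open>p\<close> the chart is
  \<open>chart_at p\<close> also while the field is differentiated, so the gradient can be replaced
  by its components in that one chart.\<close>

lemma divergence_gradient_chart_at: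
  assumes "smooth f"
  shows "divergence (gradient f) p = coord_div (metric_matrix (chart_at p))
    (grad_coord (chart_at p) f) (coords (chart_at p) p)"
proof -
  let ?c = "chart_at p"
  let ?x = "coords ?c p"
  note c = chart_at[of p]
  have x: "?x \<in> cimg ?c" by (rule coords_in_cimg[OF c(2)])
  obtain D where D: "(grad_coord ?c f has_derivative D) (at ?x)"
    using has_derivative_grad_coord[OF assms c(1) x] by blast
  have pd: "partial_deriv ?c i (\<lambda>q. gradient f q ?c $ i) p = D (axis i 1) $ i" for i
  proof -
    have "((\<lambda>q. gradient f q ?c $ i) \<circ> cinv ?c has_derivative (\<lambda>v. D v $ i)) (at ?x)"
      by (rule has_derivative_transform_within_open[OF has_derivative_vec_nth[OF D] open_cimg[OF c(1)] x])
         (simp add: gradient_component[OF assms c(1)] cinv_in_cdom c coords_cinv)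
    then show ?thesis by (simp add: partial_deriv_def frechet_derivative_eqI)
  qed
  show ?thesis
    unfolding divergence_def cov_deriv_def pd sum.distrib christoffel_trace[OF c]
      gradient_component[OF assms c]
    by (simp add: coord_div_def frechet_derivative_eqI[OF D] trace_matrix inv_metric_def)
qed

text \<open>\<open>coord_div_invariant\<close> for the transition map \<open>T\<close> and its
  Jacobian \<open>J\<close>: gradients transform by \<open>J\<close> as tangent vectors, and metric
  matrices by congruence.\<close>

lemma coord_div_grad_coord_change_chart:
  assumes "smooth f" "c \<in> A" "d \<in> A" "p \<in> cdom c" "p \<in> cdom d"
  shows "coord_div (metric_matrix c) (grad_coord c f) (coords c p)
    = coord_div (metric_matrix d) (grad_coord d f) (coords d p)"
proof -
  define T where "T = coords d \<circ> cinv c"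
  define S where "S = overlap c d"
  define J where "J y = matrix (frechet_derivative T (at y))" for y
  let ?x = "coords c p"
  have x: "?x \<in> S" using assms by (simp add: S_def coords_in_overlap)
  have S: "open S" using assms by (simp add: S_def open_overlap)
  have T: "smooth_on S T" using assms by (simp add: S_def T_def smooth_on_transition)
  have Tx: "T ?x = coords d p" using assms by (simp add: T_def cinv_coords)
  have lin: "linear (frechet_derivative T (at y))" if "y \<in> S" for y
    by (rule has_derivative_linear[OF smooth_on_has_derivative[OF T that]])
  have Jv: "J y *v v = frechet_derivative T (at y) v" if "y \<in> S" for y v
    by (simp add: J_def matrix_works lin[OF that])
  have trans: "cinv c y \<in> cdom c" "cinv c y \<in> cdom d" "coords c (cinv c y) = y"
      "coords d (cinv c y) = T y" "transition_deriv c d (cinv c y) v = J y *v v" if "y \<in> S" for y v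
    using that assms unfolding Jv[OF that]
    by (auto simp: S_def in_overlap_iff cinv_in_cdom coords_cinv T_def transition_deriv_def)
  have "J differentiable (at ?x)"
  proof (intro differentiable_vecI)
    fix i j
    have "(\<lambda>y. frechet_derivative T (at y) (axis j 1)) differentiable (at ?x)"
      by (rule smooth_on_differentiable[OF smooth_on_frechet_derivative[OF T] x])
    then show "(\<lambda>y. J y $ i $ j) differentiable (at ?x)"
      unfolding J_def matrix_def by (simp add: differentiable_vec_nth)
  qed
  then obtain J' where J': "(J has_derivative J') (at ?x)" by (auto simp: differentiable_def)
  \<comment> \<open>Identifies \<open>J'\<close> with the second derivative of the transition map,
    whose symmetry is the hypothesis \<open>sym\<close> of the invariance lemma.\<close>
  have J'v: "J' v *v w = frechet_derivative (\<lambda>y. frechet_derivative T (at y) w) (at ?x) v" for v w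
  proof -
    have "((\<lambda>y. J y *v w) has_derivative (\<lambda>v. J' v *v w)) (at ?x)"
      by (rule bounded_linear.has_derivative[OF
            bounded_bilinear.bounded_linear_left[OF bounded_bilinear_matrix_vector_mult] J'])
    then have "((\<lambda>y. frechet_derivative T (at y) w) has_derivative (\<lambda>v. J' v *v w)) (at ?x)"
      by (rule has_derivative_transform_within_open[OF _ S x]) (simp add: Jv)
    then show ?thesis by (simp add: frechet_derivative_eqI)
  qed
  obtain Xc' where Xc': "(grad_coord c f has_derivative Xc') (at ?x)"
    using has_derivative_grad_coord[OF assms(1,2) coords_in_cimg[OF assms(4)]] by blast
  obtain Xd' where Xd': "(grad_coord d f has_derivative Xd') (at (T ?x))"
    using has_derivative_grad_coord[OF assms(1,3) coords_in_cimg[OF assms(5)]] unfolding Tx by blast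
  have dimg: "T ?x \<in> cimg d" using assms by (simp add: Tx coords_in_cimg)
  have "coord_div (metric_matrix c) (grad_coord c f) ?x = coord_div (metric_matrix d) (grad_coord d f) (T ?x)"
  proof (rule coord_div_invariant[where T=T and J=J, OF S x _ J' _ Xc' Xd'
        differentiable_metric_matrix[OF assms(3) dimg, unfolded frechet_derivative_works]])
    show "(T has_derivative (*v) (J ?x)) (at ?x)"
    proof -
      have "(*v) (J ?x) = frechet_derivative T (at ?x)" by (rule ext) (rule Jv[OF x])
      then show ?thesis using smooth_on_has_derivative[OF T x] by simp
    qed
    show "J' v *v w = J' w *v v" for v w
      unfolding J'v by (rule second_derivative_symmetric[OF S x T])
    show "grad_coord d f (T y) = J y *v grad_coord c f y" if y: "y \<in> S" for y
      using tangent_space_change_chart[OF assms(2,3) _ _ gradient_in_tangent_space[OF assms(1)], of "cinv c y"]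
      by (simp add: gradient_component assms trans[OF y])
    show "metric_matrix c y = transpose (J y) ** (metric_matrix d (T y) ** J y)" if y: "y \<in> S" for y
    proof -
      \<comment> \<open>Both sides are the metric of the same two tangent vectors, written in
        \<open>c\<close> and in \<open>d\<close>; as \<open>w\<close> and \<open>z\<close> are
        arbitrary, the matrices agree.\<close>
      have "w \<bullet> (metric_matrix c y *v z) = (J y *v w) \<bullet> (metric_matrix d (T y) *v (J y *v z))" for w z
        using metric_tvec_of[OF assms(2) trans(1)[OF y], of w z]
          metric_tvec_of[OF assms(3) trans(2)[OF y], of "J y *v w" "J y *v z"]
          tvec_of_change_chart[OF assms(2,3) trans(1,2)[OF y]]
        by (simp add: trans[OF y])
      moreover have "(J y *v w) \<bullet> (metric_matrix d (T y) *v (J y *v z))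
          = w \<bullet> (transpose (J y) ** (metric_matrix d (T y) ** J y) *v z)" for w z
        unfolding matrix_vector_mul_assoc[symmetric] by simp (metis dot_lmul_matrix inner_commute)
      ultimately have "w \<bullet> (metric_matrix c y *v z)
          = w \<bullet> (transpose (J y) ** (metric_matrix d (T y) ** J y) *v z)" for w z
        by simp
      then have "metric_matrix c y *v z = (transpose (J y) ** (metric_matrix d (T y) ** J y)) *v z" for z
        using vector_eq_ldot by blast
      then show ?thesis by (simp add: matrix_eq)
    qed
    show "invertible (J ?x)"
    proof -
      \<comment> \<open>The derivative of the transition back from \<open>d\<close> to
        \<open>c\<close> is a left inverse, by the cocycle rule.\<close>
      have "v = 0" if "J ?x *v v = 0" for v
      proof -
        have "transition_deriv c d p v = 0"
          using that trans(5)[OF x, of v] assms by (simp add: cinv_coords)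
        then have "transition_deriv d c p (transition_deriv c d p v) = 0"
          using linear_transition_deriv[of d c p] assms by (simp add: linear_0)
        then show ?thesis
          using assms by (simp add: transition_deriv_trans transition_deriv_self)
      qed
      then show ?thesis unfolding invertible_left_inverse matrix_left_invertible_ker by blast
    qed
    show "invertible (metric_matrix d (T ?x))" by (rule invertible_metric_matrix[OF assms(3) dimg])
  qed
  then show ?thesis by (simp add: Tx)
qed

theorem divergence_gradient_chart:
  assumes "smooth f" "c \<in> A" "p \<in> cdom c"
  shows "divergence (gradient f) p =
    (\<Sum>i\<in>UNIV. \<Sum>j\<in>UNIV. inv_metric c (coords c p) $ i $ j * d2coord c f i j (coords c p))
     + (\<Sum>j\<in>UNIV. lap_drift (metric_matrix c) j (coords c p) * dcoord c f (coords c p) $ j)"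
  using divergence_gradient_chart_at[OF assms(1)]
    coord_div_grad_coord_change_chart[OF assms(1,2) chart_at(1) assms(3) chart_at(2)]
    coord_div_grad_coord[OF assms(1,2) coords_in_cimg[OF assms(3)]]
  by simp

end

subsection \<open>Functions with harmonic logarithm\<close>

context riemannian_manifold
begin

definition lap :: "('a \<Rightarrow> real) \<Rightarrow> 'a \<Rightarrow> real" where
  "lap f p = divergence (gradient f) p"

definition gprod :: "('a \<Rightarrow> real) \<Rightarrow> ('a \<Rightarrow> real) \<Rightarrow> 'a \<Rightarrow> real" where
  "gprod f h p = g p (gradient f p) (gradient h p)"

lemma tau_eq: "tau \<phi> p = Complex (lap (\<lambda>q. Re (\<phi> q)) p) (lap (\<lambda>q. Im (\<phi> q)) p)"
  by (simp add: tau_def divergence_C_def gradient_C_def lap_def)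

lemma kappa_eq: "kappa \<phi> \<psi> p = Complex
    (gprod (\<lambda>q. Re (\<phi> q)) (\<lambda>q. Re (\<psi> q)) p - gprod (\<lambda>q. Im (\<phi> q)) (\<lambda>q. Im (\<psi> q)) p)
    (gprod (\<lambda>q. Re (\<phi> q)) (\<lambda>q. Im (\<psi> q)) p + gprod (\<lambda>q. Im (\<phi> q)) (\<lambda>q. Re (\<psi> q)) p)"
  by (simp add: kappa_def metric_C_def gradient_C_def gprod_def)

lemma lap_lincomb:
  assumes "smooth f" "smooth h"
  shows "lap (\<lambda>q. a * f q + b * h q) p = a * lap f p + b * lap h p"
proof -
  note c = chart_at[of p]
  note x = coords_in_cimg[OF c(2)]
  show ?thesis
    unfolding lap_def divergence_gradient_chart[OF assms(1) c] divergence_gradient_chart[OF assms(2) c]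
      divergence_gradient_chart[OF smooth_lincomb[OF assms] c]
      dcoord_lincomb[OF assms c(1) x] d2coord_lincomb[OF assms c(1) x]
    by (simp add: sum.distrib sum_distrib_left algebra_simps)
qed

lemma gprod_commute: "smooth f \<Longrightarrow> smooth h \<Longrightarrow> gprod f h p = gprod h f p"
  unfolding gprod_def by (intro g_sym gradient_in_tangent_space)

lemma gprod_lincomb_left:
  assumes "smooth f" "smooth h" "smooth k"
  shows "gprod (\<lambda>q. a * f q + b * h q) k p = a * gprod f k p + b * gprod h k p"
proof -
  note c = chart_at[of p]
  note x = coords_in_cimg[OF c(2)]
  show ?thesis
    unfolding gprod_def metric_gradient[OF assms(1,3) c] metric_gradient[OF assms(2,3) c]
      metric_gradient[OF smooth_lincomb[OF assms(1,2)] assms(3) c] dcoord_lincomb[OF assms(1,2) c(1) x]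
    by (simp add: sum.distrib sum_distrib_left algebra_simps)
qed

lemma gprod_lincomb_right:
  assumes "smooth f" "smooth h" "smooth k"
  shows "gprod k (\<lambda>q. a * f q + b * h q) p = a * gprod k f p + b * gprod k h p"
  using gprod_lincomb_left[OF assms, of a b p] gprod_commute[OF assms(3) smooth_lincomb[OF assms(1,2)], of a b p]
    gprod_commute[OF assms(1,3), of p] gprod_commute[OF assms(2,3), of p]
  by simp

lemma smooth_Re: "smooth \<phi> \<Longrightarrow> smooth (\<lambda>q. Re (\<phi> q))"
  by (rule smooth_bounded_linear[OF _ bounded_linear_Re])

lemma smooth_Im: "smooth \<phi> \<Longrightarrow> smooth (\<lambda>q. Im (\<phi> q))"
  by (rule smooth_bounded_linear[OF _ bounded_linear_Im])

lemma smooth_diff_scale: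
  fixes \<phi> \<psi> :: "'a \<Rightarrow> complex"
  assumes "smooth \<phi>" "smooth \<psi>"
  shows "smooth (\<lambda>q. \<phi> q - k * \<psi> q)"
proof -
  have "smooth (\<lambda>q. \<phi> q + (- k) * \<psi> q)"
    by (intro smooth_add assms smooth_bounded_linear[OF _ bounded_linear_mult_right])
  then show ?thesis by simp
qed

text \<open>The factors 1 and the placement of the signs give every expression the literal shape
  \<open>a * f q + b * h q\<close>, so that the rules for linear combinations rewrite it.\<close>

lemma Re_Im_diff_scale:
  "Re (z - k * w) = 1 * Re z + 1 * (- Re k * Re w + Im k * Im w)"
  "Im (z - k * w) = 1 * Im z + 1 * (- Im k * Re w + - Re k * Im w)"
  by (simp_all add: algebra_simps)

lemma tau_diff_scale:
  assumes "smooth \<phi>" "smooth \<psi>"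
  shows "tau (\<lambda>q. \<phi> q - k * \<psi> q) p = tau \<phi> p - k * tau \<psi> p"
  unfolding tau_eq Re_Im_diff_scale
  by (simp only: lap_lincomb smooth_lincomb smooth_Re smooth_Im assms)
     (simp add: complex_eq_iff algebra_simps)

lemma kappa_diff_scale:
  assumes "smooth \<phi>" "smooth \<psi>"
  shows "kappa (\<lambda>q. \<phi> q - k * \<psi> q) (\<lambda>q. \<phi> q - k * \<psi> q) p
    = kappa \<phi> \<phi> p - 2 * k * kappa \<phi> \<psi> p + k\<^sup>2 * kappa \<psi> \<psi> p"
proof -
  note s = smooth_lincomb smooth_Re smooth_Im assms
  have c: "gprod (\<lambda>q. Re (\<psi> q)) (\<lambda>q. Re (\<phi> q)) p = gprod (\<lambda>q. Re (\<phi> q)) (\<lambda>q. Re (\<psi> q)) p"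
    "gprod (\<lambda>q. Re (\<psi> q)) (\<lambda>q. Im (\<phi> q)) p = gprod (\<lambda>q. Im (\<phi> q)) (\<lambda>q. Re (\<psi> q)) p"
    "gprod (\<lambda>q. Im (\<psi> q)) (\<lambda>q. Re (\<phi> q)) p = gprod (\<lambda>q. Re (\<phi> q)) (\<lambda>q. Im (\<psi> q)) p"
    "gprod (\<lambda>q. Im (\<psi> q)) (\<lambda>q. Im (\<phi> q)) p = gprod (\<lambda>q. Im (\<phi> q)) (\<lambda>q. Im (\<psi> q)) p"
    "gprod (\<lambda>q. Im (\<phi> q)) (\<lambda>q. Re (\<phi> q)) p = gprod (\<lambda>q. Re (\<phi> q)) (\<lambda>q. Im (\<phi> q)) p"
    "gprod (\<lambda>q. Im (\<psi> q)) (\<lambda>q. Re (\<psi> q)) p = gprod (\<lambda>q. Re (\<psi> q)) (\<lambda>q. Im (\<psi> q)) p"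
    by (intro gprod_commute s)+
  show ?thesis
    unfolding kappa_eq Re_Im_diff_scale
    by (simp only: gprod_lincomb_left gprod_lincomb_right s c)
       (simp add: complex_eq_iff power2_eq_square algebra_simps)
qed

text \<open>The identity \<open>F \<Delta>F = |\<nabla>F|\<^sup>2\<close> for \<open>F = |\<zeta>|\<^sup>2 = u\<^sup>2 + v\<^sup>2\<close>, which says that
  \<open>log F\<close> is harmonic: \<open>P\<close>, \<open>Q\<close>, \<open>S\<close> are the products of the gradients of \<open>u\<close> and \<open>v\<close>, and
  \<open>Lu\<close>, \<open>Lv\<close> their Laplacians.\<close>

lemma log_harmonic_identity:
  fixes u v P Q S Lu Lv l m :: real
  assumes "Lu = l * u - m * v" "Lv = m * u + l * v"
    and "P - Q = l * (u * u - v * v) - 2 * m * u * v"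
    and "2 * S = 2 * l * u * v + m * (u * u - v * v)"
  shows "(u * u + v * v) * (2 * u * Lu + 2 * v * Lv + 2 * P + 2 * Q)
    - 4 * (u * u * P + v * v * Q + 2 * u * v * S) = 0"
proof -
  \<comment> \<open>The real and imaginary parts of the equation for \<open>kappa\<close> fix only
    \<open>P - Q\<close> and \<open>S\<close>. The remaining unknown \<open>Q\<close> cancels, with
    total coefficient 4 (u^2 + v^2) - 4 u^2 - 4 v^2.\<close>
  have P: "P = Q + l * (u * u - v * v) - 2 * m * u * v" using assms(3) by simp
  have S: "8 * u * v * S = 4 * u * v * (2 * l * u * v + m * (u * u - v * v))"
    unfolding assms(4)[symmetric] by simp
  have "(u * u + v * v) * (2 * u * Lu + 2 * v * Lv + 2 * P + 2 * Q)
    - 4 * (u * u * P + v * v * Q + 2 * u * v * S)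
    = (u * u + v * v) * (2 * u * Lu + 2 * v * Lv + 2 * P + 2 * Q)
    - 4 * (u * u * P + v * v * Q) - 8 * u * v * S" by (simp add: algebra_simps)
  also have "\<dots> = 0" unfolding S P assms(1,2) by (simp add: algebra_simps)
  finally show ?thesis .
qed

context
  fixes \<zeta> :: "'a \<Rightarrow> complex" and lam :: complex
  assumes smooth: "smooth \<zeta>"
    and tau: "\<And>p. tau \<zeta> p = lam * \<zeta> p"
    and kappa: "\<And>p. kappa \<zeta> \<zeta> p = lam * \<zeta> p * \<zeta> p"
begin

text \<open>One chart around \<open>p\<close> is kept throughout; the neighbourhood is the preimage
  of the coordinate ball supplied by the maximum principle.\<close>

lemma norm_square_locally_constant:
  assumes max: "\<And>q. (norm (\<zeta> q))\<^sup>2 \<le> (norm (\<zeta> p))\<^sup>2" and pos: "\<zeta> p \<noteq> 0"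
  shows "\<exists>W. open W \<and> p \<in> W \<and> (\<forall>q\<in>W. (norm (\<zeta> q))\<^sup>2 = (norm (\<zeta> p))\<^sup>2)"
proof -
  define c where "c = chart_at p"
  have c: "c \<in> A" "p \<in> cdom c" by (simp_all add: c_def chart_at)
  define u where "u = (\<lambda>q. Re (\<zeta> q))"
  define v where "v = (\<lambda>q. Im (\<zeta> q))"
  have su: "smooth u" and sv: "smooth v" using smooth by (simp_all add: u_def v_def smooth_Re smooth_Im)
  define U0 where "U0 = u \<circ> cinv c"
  define V0 where "V0 = v \<circ> cinv c"
  define F where "F x = U0 x * U0 x + V0 x * V0 x" for x
  define F1 where "F1 i x = 2 * (U0 x * dcoord c u x $ i + V0 x * dcoord c v x $ i)" for i x
  define F2 where "F2 i j x = 2 * (dcoord c u x $ j * dcoord c u x $ i + U0 x * d2coord c u i j x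
    + dcoord c v x $ j * dcoord c v x $ i + V0 x * d2coord c v i j x)" for i j x
  define H where "H = inv_metric c"
  define \<beta> where "\<beta> = lap_drift (metric_matrix c)"
  \<comment> \<open>Zeros of \<open>F\<close> are excluded because \<open>F\<close> multiplies the
    leading coefficients.\<close>
  define U where "U = {x \<in> cimg c. F x \<noteq> 0}"
  have Fnorm: "F x = (norm (\<zeta> (cinv c x)))\<^sup>2" for x
    unfolding F_def U0_def V0_def u_def v_def cmod_power2 by (simp add: power2_eq_square)
  have Fnn: "F x \<ge> 0" for x by (simp add: F_def)
  have dU: "(U0 has_derivative (\<lambda>w. \<Sum>i\<in>UNIV. dcoord c u x $ i * w $ i)) (at x)"
    and dV: "(V0 has_derivative (\<lambda>w. \<Sum>i\<in>UNIV. dcoord c v x $ i * w $ i)) (at x)"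
    if "x \<in> cimg c" for x
    unfolding U0_def V0_def by (intro has_derivative_chart su sv c that)+
  have F1: "(F has_derivative (\<lambda>w. \<Sum>i\<in>UNIV. F1 i x * w $ i)) (at x)" if "x \<in> cimg c" for x
    unfolding F_def[abs_def]
    by (rule has_derivative_eq_rhs[OF has_derivative_add[OF
          has_derivative_mult[OF dU[OF that] dU[OF that]] has_derivative_mult[OF dV[OF that] dV[OF that]]]])
       (simp add: F1_def sum_distrib_left sum_distrib_right sum.distrib[symmetric] algebra_simps)
  have F2: "(F1 i has_derivative (\<lambda>w. \<Sum>j\<in>UNIV. F2 i j x * w $ j)) (at x)" if "x \<in> cimg c" for i x
    unfolding F1_def[abs_def]
    by (rule has_derivative_eq_rhs[OF has_derivative_mult_right[OF has_derivative_add[OF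
          has_derivative_mult[OF dU[OF that] has_derivative_dcoord_nth[OF su c(1) that]]
          has_derivative_mult[OF dV[OF that] has_derivative_dcoord_nth[OF sv c(1) that]]]]])
       (simp add: F2_def sum_distrib_left sum_distrib_right sum.distrib[symmetric] algebra_simps)
  have cF: "continuous_on (cimg c) F"
    using F1 has_derivative_continuous continuous_at_imp_continuous_on by blast
  have cF1: "continuous_on (cimg c) (F1 i)" for i
    using F2 has_derivative_continuous continuous_at_imp_continuous_on by blast
  have cH: "continuous_on (cimg c) H" by (simp add: H_def continuous_on_inv_metric c)
  have c\<beta>: "continuous_on (cimg c) (\<beta> j)" for j
    unfolding \<beta>_def using continuous_on_inv_metric[OF c(1)]
    by (intro continuous_on_lap_drift continuous_on_frechet_derivative_metric_matrix c)
       (simp add: inv_metric_def[abs_def])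
  have "U \<subseteq> cimg c" by (auto simp: U_def)
  \<comment> \<open>Coefficients of F Lap - g(grad F, grad .), with F and its gradient treated as
    given functions; applied to a positive F this is F^2 times the Laplacian of log F.\<close>
  define a where "a i j x = F x * H x $ i $ j" for i j x
  define b where "b j x = F x * \<beta> j x - (\<Sum>i\<in>UNIV. H x $ i $ j * F1 i x)" for j x
  have ell: "elliptic U a b"
  proof
    have "U = cimg c \<inter> F -` (- {0})" by (auto simp: U_def)
    then show "open U"
      using continuous_open_preimage[OF cF open_cimg[OF c(1)], of "- {0}"] by auto
    show "continuous_on U (a i j)" for i j
      unfolding a_def
      by (intro continuous_intros continuous_on_component
          continuous_on_subset[OF cF \<open>U \<subseteq> cimg c\<close>] continuous_on_subset[OF cH \<open>U \<subseteq> cimg c\<close>])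
    show "continuous_on U (b j)" for j
      unfolding b_def
      by (intro continuous_intros continuous_on_component
          continuous_on_subset[OF cF \<open>U \<subseteq> cimg c\<close>] continuous_on_subset[OF cH \<open>U \<subseteq> cimg c\<close>]
          continuous_on_subset[OF c\<beta> \<open>U \<subseteq> cimg c\<close>] continuous_on_subset[OF cF1 \<open>U \<subseteq> cimg c\<close>])
    show "a i j x = a j i x" if "x \<in> U" for i j x
      using inv_metric_sym[OF c(1), of x i j] that by (simp add: a_def H_def U_def)
    show "(\<Sum>i\<in>UNIV. \<Sum>j\<in>UNIV. a i j x * w $ i * w $ j) > 0" if "x \<in> U" "w \<noteq> 0" for x w
    proof -
      have "(\<Sum>i\<in>UNIV. \<Sum>j\<in>UNIV. a i j x * w $ i * w $ j) = F x * (w \<bullet> (H x *v w))"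
        by (simp add: a_def inner_vec_def matrix_vector_mult_def sum_distrib_left algebra_simps)
      moreover have "F x > 0" using Fnn[of x] that by (auto simp: U_def)
      moreover have "w \<bullet> (H x *v w) > 0"
        unfolding H_def using that c by (intro inv_metric_posdef) (auto simp: U_def)
      ultimately show ?thesis by simp
    qed
  qed
  have zero: "elliptic_op a b F1 F2 x = 0" if x: "x \<in> cimg c" for x
  proof -
    let ?q = "cinv c x"
    have q: "?q \<in> cdom c" "coords c ?q = x" using x c by (simp_all add: cinv_in_cdom coords_cinv)
    define L where "L f = (\<Sum>i\<in>UNIV. \<Sum>j\<in>UNIV. H x $ i $ j * d2coord c f i j x)
      + (\<Sum>j\<in>UNIV. \<beta> j x * dcoord c f x $ j)" for f
    define B where "B f h = (\<Sum>i\<in>UNIV. \<Sum>j\<in>UNIV. H x $ i $ j * dcoord c f x $ i * dcoord c h x $ j)" for f h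
    have L: "lap f ?q = L f" if "smooth f" for f
      using divergence_gradient_chart[OF that c(1) q(1)] by (simp add: lap_def L_def H_def \<beta>_def q)
    have B: "gprod f h ?q = B f h" if "smooth f" "smooth h" for f h
      using metric_gradient[OF that c(1) q(1)] by (simp add: gprod_def B_def H_def q)
    have Bs: "B v u = B u v" using B[OF su sv] B[OF sv su] gprod_commute[OF su sv] by simp
    have Z: "Re (\<zeta> ?q) = U0 x" "Im (\<zeta> ?q) = V0 x"
      by (simp_all add: U0_def V0_def u_def v_def)
    have "Complex (L u) (L v) = lam * \<zeta> ?q"
      using tau[of ?q] unfolding tau_eq u_def[symmetric] v_def[symmetric] by (simp add: L su sv)
    then have Lu: "L u = Re lam * U0 x - Im lam * V0 x" and Lv: "L v = Im lam * U0 x + Re lam * V0 x"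
      by (simp_all add: complex_eq_iff Z)
    have "Complex (B u u - B v v) (B u v + B v u) = lam * \<zeta> ?q * \<zeta> ?q"
      using kappa[of ?q] unfolding kappa_eq u_def[symmetric] v_def[symmetric] by (simp add: B su sv)
    then have P: "B u u - B v v = Re lam * (U0 x * U0 x - V0 x * V0 x) - 2 * Im lam * U0 x * V0 x"
      and S: "2 * B u v = 2 * Re lam * U0 x * V0 x + Im lam * (U0 x * U0 x - V0 x * V0 x)"
      by (simp_all add: Bs complex_eq_iff Z algebra_simps)
    have 1: "(\<Sum>i\<in>UNIV. \<Sum>j\<in>UNIV. H x $ i $ j * F2 i j x) + (\<Sum>j\<in>UNIV. \<beta> j x * F1 j x)
        = 2 * U0 x * L u + 2 * V0 x * L v + 2 * B u u + 2 * B v v"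
    proof -
      have "(\<Sum>i\<in>UNIV. \<Sum>j\<in>UNIV. H x $ i $ j * F2 i j x)
          = 2 * U0 x * (\<Sum>i\<in>UNIV. \<Sum>j\<in>UNIV. H x $ i $ j * d2coord c u i j x)
            + 2 * V0 x * (\<Sum>i\<in>UNIV. \<Sum>j\<in>UNIV. H x $ i $ j * d2coord c v i j x)
            + 2 * B u u + 2 * B v v"
        unfolding B_def sum_distrib_left sum.distrib[symmetric]
        by (intro sum.cong refl) (simp add: F2_def algebra_simps)
      moreover have "(\<Sum>j\<in>UNIV. \<beta> j x * F1 j x)
          = 2 * U0 x * (\<Sum>j\<in>UNIV. \<beta> j x * dcoord c u x $ j)
            + 2 * V0 x * (\<Sum>j\<in>UNIV. \<beta> j x * dcoord c v x $ j)"
        unfolding sum_distrib_left sum.distrib[symmetric]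
        by (intro sum.cong refl) (simp add: F1_def algebra_simps)
      ultimately show ?thesis unfolding L_def distrib_left by linarith
    qed
    have 2: "(\<Sum>j\<in>UNIV. \<Sum>i\<in>UNIV. H x $ i $ j * F1 i x * F1 j x)
        = 4 * (U0 x * U0 x * B u u + V0 x * V0 x * B v v + 2 * U0 x * V0 x * B u v)"
    proof -
      have "(\<Sum>j\<in>UNIV. \<Sum>i\<in>UNIV. H x $ i $ j * F1 i x * F1 j x)
          = (\<Sum>i\<in>UNIV. \<Sum>j\<in>UNIV. H x $ i $ j * F1 i x * F1 j x)"
        by (rule sum.swap)
      also have "\<dots> = 4 * (U0 x * U0 x * B u u + V0 x * V0 x * B v v + U0 x * V0 x * B u v + U0 x * V0 x * B v u)"
        unfolding B_def F1_def distrib_left sum_distrib_left sum.distrib[symmetric]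
        by (intro sum.cong refl) (simp add: algebra_simps)
      finally show ?thesis by (simp add: Bs)
    qed
    \<comment> \<open>Regrouped as F Lap F - |grad F|^2, the combination to which the identity for
      harmonic logarithms applies.\<close>
    have "elliptic_op a b F1 F2 x
        = F x * ((\<Sum>i\<in>UNIV. \<Sum>j\<in>UNIV. H x $ i $ j * F2 i j x) + (\<Sum>j\<in>UNIV. \<beta> j x * F1 j x))
          - (\<Sum>j\<in>UNIV. \<Sum>i\<in>UNIV. H x $ i $ j * F1 i x * F1 j x)"
      unfolding elliptic_op_def a_def b_def left_diff_distrib sum_subtractf distrib_left
        sum_distrib_left sum_distrib_right
      by (simp add: mult.assoc)
    also have "\<dots> = 0"
      unfolding 1 2 F_def by (rule log_harmonic_identity[OF Lu Lv P S])
    finally show ?thesis .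
  qed
  let ?x0 = "coords c p"
  have x0: "cinv c ?x0 = p" "?x0 \<in> cimg c" using c by (simp_all add: cinv_coords coords_in_cimg)
  have "\<exists>r>0. \<forall>y\<in>ball ?x0 r. F y = F ?x0"
  proof (rule elliptic.strong_maximum_principle[OF ell, of ?x0 F F1 F2])
    show "?x0 \<in> U" using x0 pos by (simp add: U_def Fnorm)
    show "F x \<le> F ?x0" for x using max x0 by (simp add: Fnorm)
  qed (use F1 F2 zero \<open>U \<subseteq> cimg c\<close> in auto)
  then obtain r where r: "r > 0" "\<And>y. y \<in> ball ?x0 r \<Longrightarrow> F y = F ?x0" by blast
  define W where "W = cdom c \<inter> coords c -` ball ?x0 r"
  have "open W" unfolding W_def
    by (rule continuous_open_preimage[OF continuous_on_coords open_cdom]) (use c in auto)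
  moreover have "p \<in> W" using c r by (simp add: W_def)
  moreover have "(norm (\<zeta> q))\<^sup>2 = (norm (\<zeta> p))\<^sup>2" if "q \<in> W" for q
    using r(2)[of "coords c q"] that x0 by (simp add: W_def Fnorm cinv_coords[OF c(1)])
  ultimately show ?thesis by blast
qed

lemma zero_or_nonvanishing:
  assumes "compact (UNIV :: 'a set)" "connected (UNIV :: 'a set)" "\<zeta> p0 = 0"
  shows "\<zeta> q = 0"
proof -
  define f where "f q = (norm (\<zeta> q))\<^sup>2" for q
  have cf: "continuous_on UNIV f"
    unfolding f_def by (intro continuous_intros smooth_continuous_on smooth)
  then obtain p where p: "\<And>q. f q \<le> f p"
    using continuous_attains_sup[OF assms(1), of f] by auto
  have "\<zeta> p = 0"
  proof (rule ccontr)
    assume "\<zeta> p \<noteq> 0"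
    define S where "S = {q. f q = f p}"
    have "open S"
    proof (subst open_subopen, intro ballI)
      fix q assume "q \<in> S"
      then have "f q = f p" by (simp add: S_def)
      \<comment> \<open>Every point of \<open>S\<close> is itself a global maximum with nonzero
        value, so the local statement applies there and not only at \<open>p\<close>.\<close>
      then have "\<zeta> q \<noteq> 0" using \<open>\<zeta> p \<noteq> 0\<close> by (auto simp: f_def)
      then obtain W where "open W" "q \<in> W" "\<And>q'. q' \<in> W \<Longrightarrow> f q' = f q"
        using norm_square_locally_constant[of q] p \<open>f q = f p\<close> unfolding f_def by metis
      then show "\<exists>W. open W \<and> q \<in> W \<and> W \<subseteq> S"
        using \<open>f q = f p\<close> by (auto simp: S_def)
    qed
    moreover have "closed S"
      using continuous_closed_preimage_constant[OF cf closed_UNIV, of "f p"] by (simp add: S_def)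
    ultimately have "S = {} \<or> - S = {}"
      using connectedD[OF assms(2), of S "- S"] by auto
    then have "f p0 = f p" by (auto simp: S_def)
    then show False using assms(3) \<open>\<zeta> p \<noteq> 0\<close> by (simp add: f_def)
  qed
  then show ?thesis using p[of q] by (simp add: f_def)
qed

end

lemma eigenfamily_proportional:
  assumes "compact (UNIV :: 'a set)" "connected (UNIV :: 'a set)" "eigenfamily lam lam F"
    and "\<phi> \<in> F" "\<psi> \<in> F" "\<psi> p \<noteq> 0"
  shows "\<phi> = cscale (\<phi> p / \<psi> p) \<psi>"
proof
  fix q
  define k where "k = \<phi> p / \<psi> p"
  define \<zeta> where "\<zeta> q = \<phi> q - k * \<psi> q" for q
  have s: "smooth \<phi>" "smooth \<psi>" using assms(3-5) by (auto simp: eigenfamily_def)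
  have t: "tau \<phi> p = lam * \<phi> p" "tau \<psi> p = lam * \<psi> p"
      "kappa \<phi> \<phi> p = lam * \<phi> p * \<phi> p" "kappa \<phi> \<psi> p = lam * \<phi> p * \<psi> p"
      "kappa \<psi> \<psi> p = lam * \<psi> p * \<psi> p" for p
    using assms(3-5) by (auto simp: eigenfamily_def)
  have "\<zeta> q = 0"
  proof (rule zero_or_nonvanishing[of \<zeta> lam p])
    show "smooth \<zeta>" unfolding \<zeta>_def by (rule smooth_diff_scale[OF s])
    show "tau \<zeta> p = lam * \<zeta> p" for p
      unfolding \<zeta>_def tau_diff_scale[OF s] t by (simp add: algebra_simps)
    \<comment> \<open>The mixed condition on \<open>kappa \<phi> \<psi>\<close> is what completes
      the square here.\<close>
    show "kappa \<zeta> \<zeta> p = lam * \<zeta> p * \<zeta> p" for p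
      unfolding \<zeta>_def kappa_diff_scale[OF s] t by (simp add: algebra_simps power2_eq_square)
    show "\<zeta> p = 0" using assms(6) by (simp add: \<zeta>_def k_def)
  qed (rule assms)+
  then show "\<phi> q = cscale (\<phi> p / \<psi> p) \<psi> q" by (simp add: \<zeta>_def k_def cscale_def)
qed

end

theorem proposition1p2:
  fixes A :: "('a::{t2_space, second_countable_topology}, 'n::finite) chart set"
    and g :: "'a \<Rightarrow> ('a, 'n) tvec \<Rightarrow> ('a, 'n) tvec \<Rightarrow> real"
    and lam :: complex
    and F :: "('a \<Rightarrow> complex) set"
  assumes "riemannian_manifold A g"
    and "compact (UNIV :: 'a set)"
    and "connected (UNIV :: 'a set)"
    and "riemannian_manifold.eigenfamily A g lam lam F"
  shows "cfun_fin_dim (cfun_span F) \<and> cfun_dim (cfun_span F) \<le> 1"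
proof -
  interpret riemannian_manifold A g by fact
  \<comment> \<open>A single generator gives the finite spanning set and the dimension bound at
    once.\<close>
  have "\<exists>\<psi>. cfun_span F = cfun_span {\<psi>}"
  proof (cases "\<exists>\<psi>\<in>F. \<exists>p. \<psi> p \<noteq> 0")
    case True
    then obtain \<psi> p where \<psi>: "\<psi> \<in> F" "\<psi> p \<noteq> 0" by blast
    have "\<phi> \<in> cfun_span {\<psi>}" if "\<phi> \<in> F" for \<phi>
    proof -
      have "\<phi> = cscale (\<phi> p / \<psi> p) \<psi>"
        by (rule eigenfamily_proportional[OF assms(2-4) that \<psi>])
      then show ?thesis by (metis cfun.span_base cfun.span_scale singletonI)
    qed
    then have "cfun_span F \<subseteq> cfun_span {\<psi>}" by (intro cfun.span_minimal cfun.subspace_span) auto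
    moreover have "cfun_span {\<psi>} \<subseteq> cfun_span F" using \<psi> by (intro cfun.span_mono) auto
    ultimately show ?thesis by blast
  next
    case False
    \<comment> \<open>The family is empty or consists of the zero function; the generator is then 0,
      so this case has the same form as the other one.\<close>
    then have "F \<subseteq> {0}" by (auto simp: fun_eq_iff)
    then have "cfun_span F = cfun_span {0}"
      by (metis cfun.span_empty cfun.span_insert_0 subset_singletonD)
    then show ?thesis by blast
  qed
  then obtain \<psi> where \<psi>: "cfun_span F = cfun_span {\<psi>}" by blast
  have "cfun_dim (cfun_span {\<psi>}) \<le> card {\<psi>}"
    by (rule cfun.dim_le_card) (auto intro: cfun.span_base)
  then show ?thesis
    unfolding cfun_fin_dim_def \<psi> by (auto intro: exI[of _ "{\<psi>}"])
qed

end
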